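(* Let $F\subseteq K$ be an arbitrary field extension. Then each of $\mathrm{rr}(F^\times)$ and $\mathrm{rr}(K^\times/F^\times)$ is either $0$ or infinite.
   Context: For a commutative group $A$, the rational rank $\mathrm{rr}(A)$ is the cardinality of a maximal $\mathbb{Z}$-linearly independent subset of $A$; equivalently, $\mathrm{rr}(A)=\dim_{\mathbb{Q}}(A\otimes_{\mathbb{Z}}\mathbb{Q})$. *)

theory Defs
  imports "HOL-Algebra.Multiplicative_Group" "HOL-Algebra.Subrings"
begin

unbundle cardinal_syntax

text \<open>Commutative groups are written multiplicatively, so an integer linear combination of the
  elements of a finite set \<open>T\<close> is the product of the powers \<open>x [^] f x\<close> over \<open>T\<close>.\<close>

definition Z_independent :: "('a, 'b) monoid_scheme \<Rightarrow> 'a set \<Rightarrow> bool" where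
  "Z_independent G S \<longleftrightarrow> S \<subseteq> carrier G \<and>
     (\<forall>T (f :: 'a \<Rightarrow> int). finite T \<and> T \<subseteq> S \<and> (\<Otimes>\<^bsub>G\<^esub>x\<in>T. x [^]\<^bsub>G\<^esub> f x) = \<one>\<^bsub>G\<^esub>
        \<longrightarrow> (\<forall>x\<in>T. f x = 0))"

definition maximal_Z_independent :: "('a, 'b) monoid_scheme \<Rightarrow> 'a set \<Rightarrow> bool" where
  "maximal_Z_independent G S \<longleftrightarrow> Z_independent G S \<and>
     (\<forall>T. Z_independent G T \<and> S \<subseteq> T \<longrightarrow> T = S)"

text \<open>Maximal independent sets always exist (shown below), and in a commutative group any two of them have the same
  cardinality, so the choice of \<open>S\<close> is immaterial. The rank is a cardinal in the sense of the
  library, that is, a well-order relation compared by \<open>=o\<close>.\<close>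

definition rational_rank :: "('a, 'b) monoid_scheme \<Rightarrow> 'a rel" where
  "rational_rank G = |SOME S. maximal_Z_independent G S|"

lemma maximal_Z_independent_exists: "\<exists>S. maximal_Z_independent G S"
proof -
  let ?A = "Collect (Z_independent G)"
  have "\<exists>M\<in>?A. \<forall>N\<in>?A. M \<subseteq> N \<longrightarrow> N = M"
  proof (rule subset_Zorn_nonempty)
    show "?A \<noteq> {}" by (auto simp: Z_independent_def)
  next
    fix C assume ne: "C \<noteq> {}" and C: "subset.chain ?A C"
    have ind: "Z_independent G S" if "S \<in> C" for S
      using C that by (auto simp: subset.chain_def)
    have "\<forall>x\<in>T. f x = 0"
      if T: "finite T" "T \<subseteq> \<Union>C" and eq: "(\<Otimes>\<^bsub>G\<^esub>x\<in>T. x [^]\<^bsub>G\<^esub> f x) = \<one>\<^bsub>G\<^esub>"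
      for T and f :: "'a \<Rightarrow> int"
    proof -
      obtain S where "S \<in> C" "T \<subseteq> S"
        using finite_subset_Union_chain[OF T ne C] by blast
      then show ?thesis using ind T(1) eq unfolding Z_independent_def by blast
    qed
    moreover have "\<Union>C \<subseteq> carrier G" using ind by (auto simp: Z_independent_def)
    ultimately show "\<Union>C \<in> ?A" by (auto simp: Z_independent_def)
  qed
  then show ?thesis by (auto simp: maximal_Z_independent_def)
qed

end

theory Submission
  imports Defs "HOL-Decision_Procs.Algebra_Aux" "HOL-Algebra.Algebraic_Closure" "HOL-Computational_Algebra.Polynomial"
begin

text \<open>Elements \<open>b\<^sub>0, b\<^sub>1, \<dots>\<close> of a commutative group are independent modulo a subgroup \<open>N\<close> if there are
  subgroups \<open>H\<^sub>i\<close> containing \<open>N\<close> such that \<open>b\<^sub>j\<close> lies in \<open>H\<^sub>i\<close> for \<open>j < i\<close> but no positive power of \<open>b\<^sub>i\<close> does.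
  Here the \<open>H\<^sub>i\<close> come from valuation rings \<open>V\<^sub>i\<close>. The point is to find, for \<open>a\<close> algebraic over \<open>F\<close>,
  elements \<open>c\<close> of \<open>F\<close> and valuation rings in which \<open>a - c\<close> is a nonunit while finitely many prescribed
  nonzero algebraic elements are units. By Chevalley's extension theorem this needs only that
  \<open>(a - c)\<^sup>-\<^sup>1\<close> be not integral over a suitable ring. If \<open>F\<close> is algebraic over the rationals, \<open>c\<close> is an
  integer such that the value at \<open>c\<close> of the minimal polynomial of \<open>a\<close> divides no power of a given \<open>N\<close>.
  Otherwise, unless all elements in question are torsion, \<open>F\<close> is algebraic over some \<open>E(t)\<close> with \<open>t\<close>
  transcendental over \<open>E\<close>, and \<open>c\<close> is a high power of \<open>t + N\<^sup>-\<^sup>1\<close>, which forces \<open>a - c\<close> to have poles at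
  infinity and at all zeros of \<open>N\<close>.

  For the multiplicative group of a field take \<open>a = 0\<close>, and likewise for \<open>K\<^sup>\<times>/F\<^sup>\<times>\<close> if \<open>K\<close> contains an
  element transcendental over \<open>F\<close>. If \<open>x\<close> is algebraic over \<open>F\<close> and no positive power of \<open>x\<close> lies in \<open>F\<close>,
  then \<open>x\<close> has a conjugate \<open>y \<noteq> x\<close>; now \<open>b\<^sub>i = x - c\<^sub>i\<close>, and \<open>H\<^sub>i\<close> consists of those \<open>w\<close> in \<open>F(x)\<close> whose
  quotient by the conjugate of \<open>w\<close> is a unit of \<open>V\<^sub>i\<close>, so that \<open>H\<^sub>i\<close> contains \<open>F\<^sup>\<times>\<close>.\<close>

hide_const (open) Ring_Divisibility.mult_of

section \<open>Chevalley's extension theorem\<close>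

context field
begin

lemma mem_simple_extension_inv_denom:
  assumes "subring V R" "e \<in> V" "e \<noteq> \<zero>" "k \<in> simple_extension V (inv e)"
  shows "\<exists>n::nat. e [^] n \<otimes> k \<in> V"
  using assms(4)
proof (induction k)
  case zero
  then show ?case using subringE(2)[OF assms(1)] subringE(1)[OF assms(1)] assms(2)
    by (intro exI[of _ 0]) auto
next
  case (lin k1 k2)
  note V = subringE[OF assms(1)]
  then obtain n :: nat where n: "e [^] n \<otimes> k1 \<in> V" using lin by auto
  have e: "e \<in> carrier R" using V assms by auto
  have c: "k1 \<in> carrier R" "k2 \<in> carrier R" "inv e \<in> carrier R" "e [^] n \<in> carrier R"
    using simple_extension_in_carrier[OF V(1), of "inv e"] lin e assms V(1) by auto
  have pw: "e [^] m \<in> V" for m :: nat by (induction m) (use V assms in auto)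
  have "e [^] Suc n \<otimes> (k1 \<otimes> inv e \<oplus> k2) = (e [^] n \<otimes> k1) \<otimes> (e \<otimes> inv e) \<oplus> e [^] Suc n \<otimes> k2"
    unfolding nat_pow_Suc using c e by (simp add: r_distr m_ac)
  also have "\<dots> = (e [^] n \<otimes> k1) \<oplus> e [^] Suc n \<otimes> k2" using e c assms by simp
  also have "\<dots> \<in> V" using V(7)[OF n V(6)[OF pw lin.hyps(2)]] .
  finally show ?case by blast
qed

lemma subring_minus_closed: "subring V R \<Longrightarrow> a \<in> V \<Longrightarrow> b \<in> V \<Longrightarrow> a \<ominus> b \<in> V"
  by (simp add: minus_eq subringE)

lemma nat_pow_in_subring: "subring V R \<Longrightarrow> e \<in> V \<Longrightarrow> e [^] (n::nat) \<in> V"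
  by (induction n) (auto dest: subringE)

text \<open>For an ideal \<open>J\<close> of \<open>V\<close> these are the values at
  \<open>x\<close> of polynomials of degree below \<open>n\<close> with coefficients in
  \<open>J\<close>. Keeping \<open>n\<close> explicit allows a comparison of the minimal lengths in
  which 1 is represented by powers of \<open>x\<close> and of \<open>inv x\<close>.\<close>

primrec horner :: "'a set \<Rightarrow> 'a \<Rightarrow> nat \<Rightarrow> 'a set" where
  "horner J x 0 = {\<zero>}"
| "horner J x (Suc n) = {j \<oplus> x \<otimes> s | j s. j \<in> J \<and> s \<in> horner J x n}"

section \<open>Arithmetic of expressions of bounded degree over an ideal\<close>

context
  fixes V J :: "'a set"
  assumes V: "subring V R" and J: "J \<subseteq> carrier R" "\<zero> \<in> J" "\<And>a b. a \<in> J \<Longrightarrow> b \<in> J \<Longrightarrow> a \<oplus> b \<in> J"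
    "\<And>v a. v \<in> V \<Longrightarrow> a \<in> J \<Longrightarrow> v \<otimes> a \<in> J"
begin

lemma horner_carrier: "x \<in> carrier R \<Longrightarrow> horner J x n \<subseteq> carrier R"
  by (induction n) (use J in auto)

lemma horner_mult_var: "s \<in> horner J x n \<Longrightarrow> x \<in> carrier R \<Longrightarrow> x \<otimes> s \<in> horner J x (Suc n)"
  using J(2) horner_carrier[of x n] by auto (metis l_zero m_closed subsetD)

lemma horner_add:
  assumes "x \<in> carrier R"
  shows "s \<in> horner J x n \<Longrightarrow> t \<in> horner J x n \<Longrightarrow> s \<oplus> t \<in> horner J x n"
proof (induction n arbitrary: s t)
  case (Suc n)
  from Suc.prems obtain i j s' t' where *: "s = i \<oplus> x \<otimes> s'" "t = j \<oplus> x \<otimes> t'" "i \<in> J" "j \<in> J"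
    "s' \<in> horner J x n" "t' \<in> horner J x n" by auto
  have c: "i \<in> carrier R" "j \<in> carrier R" "s' \<in> carrier R" "t' \<in> carrier R"
    using * J(1) horner_carrier[OF assms] by auto
  have "s \<oplus> t = (i \<oplus> j) \<oplus> x \<otimes> (s' \<oplus> t')" unfolding * using c assms by (simp add: r_distr a_ac)
  moreover have "s' \<oplus> t' \<in> horner J x n" "i \<oplus> j \<in> J" using Suc.IH * J by auto
  ultimately show ?case by auto
qed auto

lemma horner_scale:
  assumes "x \<in> carrier R" "v \<in> V"
  shows "s \<in> horner J x n \<Longrightarrow> v \<otimes> s \<in> horner J x n"
proof (induction n arbitrary: s)
  case (Suc n)
  from Suc.prems obtain i s' where *: "s = i \<oplus> x \<otimes> s'" "i \<in> J" "s' \<in> horner J x n" by auto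
  have c: "i \<in> carrier R" "s' \<in> carrier R" "v \<in> carrier R"
    using * J(1) horner_carrier[OF assms(1)] assms(2) subringE(1)[OF V] by auto
  have "v \<otimes> s = (v \<otimes> i) \<oplus> x \<otimes> (v \<otimes> s')" unfolding * using c assms(1) by (simp add: r_distr m_ac)
  moreover have "v \<otimes> s' \<in> horner J x n" "v \<otimes> i \<in> J" using Suc.IH * J assms by auto
  ultimately show ?case by auto
qed (use subringE(1)[OF V] assms in auto)

lemma horner_Suc_iff:
  assumes "x \<in> carrier R"
  shows "s \<in> horner J x (Suc n) \<longleftrightarrow> (\<exists>t\<in>horner J x n. \<exists>j\<in>J. s = t \<oplus> j \<otimes> x [^] n)"
proof (induction n arbitrary: s)
  case 0
  have "s \<in> horner J x (Suc 0) \<longleftrightarrow> s \<in> J" for s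
  proof -
    have "s \<in> horner J x (Suc 0) \<longleftrightarrow> (\<exists>j\<in>J. s = j \<oplus> \<zero>)" using assms by auto
    then show ?thesis using subsetD[OF J(1)] by simp
  qed
  then show ?case using subsetD[OF J(1)] assms by (simp del: horner.simps(2))
next
  case (Suc n)
  note c = subsetD[OF J(1)] subsetD[OF horner_carrier[OF assms]]
  show ?case
  proof
    assume "s \<in> horner J x (Suc (Suc n))"
    then obtain i s' where *: "s = i \<oplus> x \<otimes> s'" "i \<in> J" "s' \<in> horner J x (Suc n)" by auto
    then obtain t j where **: "t \<in> horner J x n" "j \<in> J" "s' = t \<oplus> j \<otimes> x [^] n" using Suc.IH by auto
    have "x [^] n \<in> carrier R" using assms by simp
    then have "s = (i \<oplus> x \<otimes> t) \<oplus> j \<otimes> x [^] Suc n" unfolding * ** nat_pow_Suc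
      using c(1)[OF *(2)] c(1)[OF **(2)] c(2)[OF **(1)] assms by (simp add: r_distr a_ac m_ac)
    moreover have "i \<oplus> x \<otimes> t \<in> horner J x (Suc n)" using * ** by auto
    ultimately show "\<exists>t\<in>horner J x (Suc n). \<exists>j\<in>J. s = t \<oplus> j \<otimes> x [^] Suc n" using ** by auto
  next
    assume "\<exists>t\<in>horner J x (Suc n). \<exists>j\<in>J. s = t \<oplus> j \<otimes> x [^] Suc n"
    then obtain i t j where *: "i \<in> J" "t \<in> horner J x n" "j \<in> J" "s = (i \<oplus> x \<otimes> t) \<oplus> j \<otimes> x [^] Suc n" by auto
    have "x [^] n \<in> carrier R" using assms by simp
    then have "s = i \<oplus> x \<otimes> (t \<oplus> j \<otimes> x [^] n)" unfolding * nat_pow_Suc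
      using c(1)[OF *(1)] c(1)[OF *(3)] c(2)[OF *(2)] assms by (simp add: r_distr a_ac m_ac)
    moreover have "t \<oplus> j \<otimes> x [^] n \<in> horner J x (Suc n)" using Suc.IH * by blast
    ultimately show "s \<in> horner J x (Suc (Suc n))" using *(1) by auto
  qed
qed

text \<open>Multiplication by the \<open>n\<close>-th power of \<open>inv x\<close> reverses the
  coefficients of a polynomial of degree at most \<open>n\<close>.\<close>

lemma horner_reverse:
  assumes "x \<in> carrier R" "x \<noteq> \<zero>"
  shows "s \<in> horner J x (Suc n) \<Longrightarrow> inv x [^] n \<otimes> s \<in> horner J (inv x) (Suc n)"
proof (induction n arbitrary: s)
  case 0
  then obtain j where j: "j \<in> J" "s = j \<oplus> \<zero>" using assms by auto
  then have "inv x [^] (0::nat) \<otimes> s = j \<oplus> inv x \<otimes> \<zero>" using subsetD[OF J(1)] assms by simp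
  then show ?case using j(1) by auto
next
  case (Suc n)
  note c = subsetD[OF J(1)] subsetD[OF horner_carrier[OF assms(1)]]
  from Suc.prems obtain i s' where *: "s = i \<oplus> x \<otimes> s'" "i \<in> J" "s' \<in> horner J x (Suc n)" by auto
  have pc: "inv x [^] n \<in> carrier R" "inv x \<in> carrier R" using assms by simp_all
  have "inv x [^] Suc n \<otimes> s = (inv x \<otimes> x) \<otimes> (inv x [^] n \<otimes> s') \<oplus> i \<otimes> inv x [^] Suc n" unfolding * nat_pow_Suc
    using c(1)[OF *(2)] c(2)[OF *(3)] assms(1) pc by (simp add: r_distr a_ac m_ac del: r_inv l_inv)
  also have "\<dots> = (inv x [^] n \<otimes> s') \<oplus> i \<otimes> inv x [^] Suc n"
    using assms pc c(2)[OF *(3)] by simp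
  finally show ?case using Suc.IH[OF *(3)] * horner_Suc_iff[OF pc(2), of _ "Suc n"] by blast
qed

text \<open>Shifting the relation for \<open>x [^] m\<close> expresses each higher power by lower
  ones, so top terms can be replaced one at a time; their coefficients act by scaling because
  \<open>J\<close> lies in \<open>V\<close>.\<close>

lemma horner_stationary:
  assumes "x \<in> carrier R" "x [^] m \<in> horner J x m" "J \<subseteq> V"
  shows "s \<in> horner J x (m + k) \<Longrightarrow> s \<in> horner J x m"
proof (induction k arbitrary: s)
  case (Suc k)
  have *: "x [^] (m + k) \<in> horner J x (m + k)" for k :: nat
  proof (induction k)
    case (Suc k)
    have "x [^] (m + Suc k) = x \<otimes> x [^] (m + k)" using assms(1) by (simp add: m_comm)
    then show ?case using horner_mult_var[OF Suc assms(1)] by simp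
  qed (use assms in simp)
  obtain t j where "t \<in> horner J x (m + k)" "j \<in> J" "s = t \<oplus> j \<otimes> x [^] (m + k)"
    using Suc.prems horner_Suc_iff[OF assms(1)] by auto
  then have "s \<in> horner J x (m + k)" using horner_add[OF assms(1)] horner_scale[OF assms(1)] * assms(3) by blast
  then show ?case using Suc.IH by blast
qed auto

text \<open>The two-sided degree argument: \<open>1\<close> being a combination of the first \<open>n\<close> powers of \<open>x\<close> makes the powers
  of \<open>x\<^sup>-\<^sup>1\<close> from some exponent below \<open>n\<close> on redundant. Applied in both directions to minimal lengths, it shows
  that the maximal ideal cannot generate the unit ideal over both \<open>V[x]\<close> and \<open>V[x\<^sup>-\<^sup>1]\<close>.\<close>

lemma horner_descent:
  assumes x: "x \<in> carrier R" "x \<noteq> \<zero>" and JV: "J \<subseteq> V" and un: "\<And>j. j \<in> J \<Longrightarrow> \<one> \<ominus> j \<noteq> \<zero> \<and> inv (\<one> \<ominus> j) \<in> V"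
    and n: "\<one> \<in> horner J x n" and m: "\<one> \<in> horner J (inv x) m"
  shows "\<exists>m'<n. \<one> \<in> horner J (inv x) m'"
proof (cases "m < n")
  case False
  obtain n' where n': "n = Suc n'" using n by (cases n) auto
  then obtain j s where *: "\<one> = j \<oplus> x \<otimes> s" "j \<in> J" "s \<in> horner J x n'" using n by auto
  have c: "j \<in> carrier R" "s \<in> carrier R" using * J(1) horner_carrier[OF x(1)] by auto
  have j: "\<one> \<ominus> j = x \<otimes> s" using c x by (subst *(1)) algebra
  obtain n'' where n'': "n' = Suc n''"
  proof (cases n')
    case 0
    then have "s = \<zero>" using * by auto
    then show ?thesis using j un *(2) x by auto
  qed blast
  have ix: "inv x \<in> carrier R" "inv x [^] n'' \<in> carrier R" using x by simp_all
  define w where "w = inv (\<one> \<ominus> j)"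
  have w: "w \<in> V" "w \<in> carrier R" "w \<otimes> (\<one> \<ominus> j) = \<one>" using un[OF *(2)] c subringE(1)[OF V] by (auto simp: w_def)
  \<comment> \<open>Multiplying 1 = w x s by this power and reversing \<open>s\<close> expresses the
    \<open>n'\<close>-th power of \<open>inv x\<close> by lower ones, so lengths beyond
    \<open>n'\<close> become redundant.\<close>
  have "inv x [^] n' = inv x [^] n' \<otimes> (w \<otimes> (x \<otimes> s))" using w j ix by (simp add: n'')
  also have "\<dots> = (inv x \<otimes> x) \<otimes> (w \<otimes> (inv x [^] n'' \<otimes> s))" unfolding n'' nat_pow_Suc using w(2) c ix x(1) by (simp add: m_ac del: r_inv l_inv)
  also have "\<dots> = w \<otimes> (inv x [^] n'' \<otimes> s)" using x w c ix by simp
  also have "\<dots> \<in> horner J (inv x) n'"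
    using horner_scale[OF ix(1) w(1)] horner_reverse[OF x] * n'' by blast
  finally have "\<one> \<in> horner J (inv x) n'"
    using horner_stationary[OF ix(1) _ JV, of n' _ "m - n'"] m n' False by simp
  then show ?thesis using n' by auto
qed (use m in auto)

end

text \<open>The whole field qualifies, as the ring of the trivial valuation; it is excluded later by
  asking that some element lie outside.\<close>

definition valuation_ring :: "'a set \<Rightarrow> bool" where
  "valuation_ring V \<longleftrightarrow> subring V R \<and> (\<forall>x\<in>carrier R - {\<zero>}. x \<in> V \<or> inv x \<in> V)"

lemma subring_Union_chain:
  assumes "subset.chain {V. subring V R} C" "C \<noteq> {}"
  shows "subring (\<Union>C) R"
proof (rule subringI)
  have C: "subring V R" if "V \<in> C" for V using assms that by (auto simp: subset.chain_def)
  have two: "\<exists>V\<in>C. a \<in> V \<and> b \<in> V" if "a \<in> \<Union>C" "b \<in> \<Union>C" for a b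
  proof -
    obtain V W where VW: "V \<in> C" "W \<in> C" "a \<in> V" "b \<in> W" using \<open>a \<in> \<Union>C\<close> \<open>b \<in> \<Union>C\<close> by blast
    then have "V \<subseteq> W \<or> W \<subseteq> V" using assms(1) by (auto simp: subset.chain_def)
    then show ?thesis using VW by blast
  qed
  show "\<Union>C \<subseteq> carrier R" using subringE(1)[OF C] by auto
  show "\<one> \<in> \<Union>C" using subringE(3)[OF C] assms(2) by auto
  show "\<ominus> h \<in> \<Union>C" if "h \<in> \<Union>C" for h using subringE(5)[OF C] that by auto
  show "a \<otimes> b \<in> \<Union>C" "a \<oplus> b \<in> \<Union>C" if ab: "a \<in> \<Union>C" "b \<in> \<Union>C" for a b
  proof -
    obtain V where "V \<in> C" "a \<in> V" "b \<in> V" using two[OF ab] by blast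
    then have "a \<otimes> b \<in> V" "a \<oplus> b \<in> V" using subringE(6,7)[OF C] by auto
    then show "a \<otimes> b \<in> \<Union>C" "a \<oplus> b \<in> \<Union>C" using \<open>V \<in> C\<close> by auto
  qed
qed

text \<open>Let \<open>V\<close> be maximal among the subrings that contain \<open>B\<close> and
  avoid \<open>z\<close>. Every proper simple extension of \<open>V\<close> contains
  \<open>z\<close>. If neither \<open>x\<close> nor \<open>inv x\<close> were in \<open>V\<close>,
  then 1 = \<open>inv z\<close> times \<open>z\<close> would be a combination of powers of
  \<open>x\<close>, and also one of powers of \<open>inv x\<close>, with coefficients in the
  multiples of \<open>inv z\<close>; the descent on lengths refutes this.\<close>

lemma exists_valuation_ring:
  assumes B: "subring B R" and z: "z \<in> carrier R" "z \<noteq> \<zero>" "inv z \<in> B" "z \<notin> B"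
  shows "\<exists>V. valuation_ring V \<and> B \<subseteq> V \<and> z \<notin> V"
proof -
  let ?S = "{V. subring V R \<and> B \<subseteq> V \<and> z \<notin> V}"
  have "\<exists>M\<in>?S. \<forall>N\<in>?S. M \<subseteq> N \<longrightarrow> N = M"
  proof (rule subset_Zorn_nonempty)
    show "?S \<noteq> {}" using assms by auto
    fix C assume C: "C \<noteq> {}" "subset.chain ?S C"
    then have "subset.chain {V. subring V R} C" by (auto simp: subset.chain_def)
    then show "\<Union>C \<in> ?S" using subring_Union_chain[of C] C by (auto simp: subset.chain_def)
  qed
  then obtain V where VS: "V \<in> ?S" and VM: "\<forall>N\<in>?S. V \<subseteq> N \<longrightarrow> N = V" by (elim bexE)
  then have V: "subring V R" "B \<subseteq> V" "z \<notin> V" by auto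
  have max: "W = V" if "subring W R" "V \<subseteq> W" "z \<notin> W" for W
    using bspec[OF VM, of W] that V(2) by auto
  note VE = subringE[OF V(1)]
  have ext: "z \<in> simple_extension V x" if "x \<in> carrier R" "x \<notin> V" for x
    using max[OF simple_extension_is_subring[OF V(1) that(1)] simple_extension_incl[OF VE(1) that(1)]]
      simple_extension_mem[OF V(1) that(1)] that by blast
  define y where "y = inv z"
  have y: "y \<in> V" "y \<in> carrier R" "y \<noteq> \<zero>" "y \<otimes> z = \<one>"
    using z V nonzero_imp_inverse_nonzero by (auto simp: y_def)
  \<comment> \<open>\<open>J\<close> takes the place of the maximal ideal; the descent asks only
    that each 1 - j be a unit of \<open>V\<close>.\<close>
  define J where "J = (\<lambda>v. y \<otimes> v) ` V"
  have un: "\<one> \<ominus> j \<noteq> \<zero> \<and> inv (\<one> \<ominus> j) \<in> V" if jJ: "j \<in> J" for j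
  proof -
    obtain v where v: "v \<in> V" "j = y \<otimes> v" using jJ by (auto simp: J_def)
    have vc: "v \<in> carrier R" using v VE by auto
    \<comment> \<open>The product equals z - v', so its membership in \<open>V\<close> would put
      \<open>z\<close> into \<open>V\<close>.\<close>
    have ne: False if w: "w \<in> V" "v' \<in> V" "z \<otimes> (\<one> \<ominus> y \<otimes> v') = w" for w v'
    proof -
      have c: "w \<in> carrier R" "v' \<in> carrier R" using w VE by auto
      have "w \<oplus> v' = z \<otimes> (\<one> \<ominus> y \<otimes> v') \<oplus> (y \<otimes> z) \<otimes> v'" using w y c by simp
      also have "\<dots> = z \<oplus> \<zero>" using c y(2) z(1) by algebra
      also have "\<dots> = z" using z by simp
      finally have "z = w \<oplus> v'" by simp
      then show False using VE(7)[OF w(1,2)] V(3) by simp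
    qed
    have 1: "\<one> \<ominus> j \<noteq> \<zero>" using ne[of \<zero> v] v VE z by auto
    have 2: "\<one> \<ominus> j \<in> V" using v y VE(3,6) subring_minus_closed[OF V(1)] by simp
    have pw: "\<exists>v'\<in>V. (\<one> \<ominus> j) [^] n = \<one> \<ominus> y \<otimes> v'" for n :: nat
    proof (induction n)
      case 0
      then show ?case using VE y by (intro bexI[of _ \<zero>]) auto
    next
      case (Suc n)
      then obtain v' where v': "v' \<in> V" "(\<one> \<ominus> j) [^] n = \<one> \<ominus> y \<otimes> v'" by auto
      have c: "v' \<in> carrier R" using v' VE by auto
      have "(\<one> \<ominus> j) [^] Suc n = \<one> \<ominus> y \<otimes> (v \<oplus> v' \<ominus> y \<otimes> v \<otimes> v')" unfolding nat_pow_Suc v'(2) unfolding v(2)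
        using y(2) vc c by algebra
      moreover have "v \<oplus> v' \<ominus> y \<otimes> v \<otimes> v' \<in> V" using v v' y VE(6,7) subring_minus_closed[OF V(1)] by simp
      ultimately show ?case by blast
    qed
    have "inv (\<one> \<ominus> j) \<in> V"
    proof (rule ccontr)
      assume "inv (\<one> \<ominus> j) \<notin> V"
      then have "z \<in> simple_extension V (inv (\<one> \<ominus> j))" using ext 1 2 VE by auto
      then obtain n :: nat where n: "(\<one> \<ominus> j) [^] n \<otimes> z \<in> V" using mem_simple_extension_inv_denom[OF V(1) 2 1] by auto
      obtain v' where v': "v' \<in> V" "(\<one> \<ominus> j) [^] n = \<one> \<ominus> y \<otimes> v'" using pw by auto
      have "v' \<in> carrier R" using VE v' by auto
      then have "z \<otimes> (\<one> \<ominus> y \<otimes> v') = (\<one> \<ominus> j) [^] n \<otimes> z" unfolding v'(2) using z(1) y(2) by (intro m_comm) auto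
      then show False using ne[OF n v'(1)] by simp
    qed
    then show ?thesis using 1 by blast
  qed
  have J: "J \<subseteq> carrier R" "\<zero> \<in> J" "\<And>a b. a \<in> J \<Longrightarrow> b \<in> J \<Longrightarrow> a \<oplus> b \<in> J"
    "\<And>v a. v \<in> V \<Longrightarrow> a \<in> J \<Longrightarrow> v \<otimes> a \<in> J" and JV: "J \<subseteq> V"
  proof -
    show "J \<subseteq> carrier R" "J \<subseteq> V" using y VE by (auto simp: J_def)
    show "\<zero> \<in> J" using y VE(2) by (auto simp: J_def image_iff intro!: bexI[of _ \<zero>])
    show "a \<oplus> b \<in> J" if ab: "a \<in> J" "b \<in> J" for a b
    proof -
      obtain v w where "v \<in> V" "w \<in> V" "a = y \<otimes> v" "b = y \<otimes> w" using ab by (auto simp: J_def)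
      moreover have "y \<otimes> v \<oplus> y \<otimes> w = y \<otimes> (v \<oplus> w)" using y VE(1) calculation by (metis r_distr subsetD)
      ultimately show ?thesis using VE by (auto simp: J_def)
    qed
    show "v \<otimes> a \<in> J" if ab: "v \<in> V" "a \<in> J" for v a
    proof -
      obtain w where "w \<in> V" "a = y \<otimes> w" using ab by (auto simp: J_def)
      moreover have "v \<otimes> (y \<otimes> w) = y \<otimes> (v \<otimes> w)" using y VE(1) calculation ab by (metis m_lcomm subsetD)
      ultimately show ?thesis using VE ab by (auto simp: J_def)
    qed
  qed
  note H = V(1) J
  have mem: "\<exists>n. y \<otimes> k \<in> horner J x n" if "k \<in> simple_extension V x" "x \<in> carrier R" for k x
    using that(1)
  proof (induction k)
    case zero
    then show ?case using y by (intro exI[of _ 0]) auto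
  next
    case (lin k1 k2)
    then obtain n where n: "y \<otimes> k1 \<in> horner J x n" by auto
    have c: "k1 \<in> carrier R" "k2 \<in> carrier R"
      using lin VE simple_extension_in_carrier[OF VE(1) that(2)] by auto
    have "y \<otimes> (k1 \<otimes> x \<oplus> k2) = y \<otimes> k2 \<oplus> x \<otimes> (y \<otimes> k1)" using c y(2) that(2) by (simp add: r_distr a_ac m_ac)
    moreover have "y \<otimes> k2 \<in> J" using lin by (auto simp: J_def)
    ultimately have "y \<otimes> (k1 \<otimes> x \<oplus> k2) \<in> horner J x (Suc n)" using n by auto
    then show ?case by blast
  qed
  have "x \<in> V \<or> inv x \<in> V" if x: "x \<in> carrier R - {\<zero>}" for x
  proof (rule ccontr)
    assume "\<not> (x \<in> V \<or> inv x \<in> V)"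
    then have "z \<in> simple_extension V x" "z \<in> simple_extension V (inv x)" using ext x by auto
    then have ex: "\<exists>n. \<one> \<in> horner J x n" "\<exists>n. \<one> \<in> horner J (inv x) n" using mem y x
      by (metis DiffE insertI1 inv_closed)+
    \<comment> \<open>The descent, applied in both directions, makes each minimal length smaller
      than the other.\<close>
    let ?n = "LEAST n. \<one> \<in> horner J x n" and ?m = "LEAST n. \<one> \<in> horner J (inv x) n"
    have n: "\<one> \<in> horner J x ?n" "\<one> \<in> horner J (inv x) ?m" using LeastI_ex[OF ex(1)] LeastI_ex[OF ex(2)] by auto
    have x': "x \<in> carrier R" "x \<noteq> \<zero>" "inv x \<in> carrier R" "inv x \<noteq> \<zero>" "inv (inv x) = x"
      using x nonzero_imp_inverse_nonzero nonzero_inverse_inverse_eq by auto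
    obtain m' where "m' < ?n" "\<one> \<in> horner J (inv x) m'" using horner_descent[OF H x'(1,2) JV un n] by blast
    then have "?m < ?n" using Least_le[of "\<lambda>n. \<one> \<in> horner J (inv x) n" m'] by simp
    obtain n' where "n' < ?m" "\<one> \<in> horner J x n'"
      using horner_descent[OF H x'(3,4) JV un n(2)] n(1) unfolding x'(5) by blast
    then have "?n < ?m" using Least_le[of "\<lambda>n. \<one> \<in> horner J x n" n'] by simp
    then show False using \<open>?m < ?n\<close> by simp
  qed
  then show ?thesis using V unfolding valuation_ring_def by blast
qed


section \<open>Integral elements and valuations\<close>

lemma valuation_ring_subring: "valuation_ring V \<Longrightarrow> subring V R"
  by (simp add: valuation_ring_def)

lemma valuation_ring_total: "valuation_ring V \<Longrightarrow> x \<in> carrier R \<Longrightarrow> x \<noteq> \<zero> \<Longrightarrow> x \<in> V \<or> inv x \<in> V"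
  by (simp add: valuation_ring_def)

text \<open>If \<open>w\<close> times \<open>x\<close> is not in \<open>V\<close>, then the inverse
  r of \<open>x\<close> is. Dividing the equation by \<open>h\<close> and by the top power of
  \<open>x\<close> and multiplying by \<open>w\<close> gives w = - r v with v in \<open>V\<close>,
  so w x = - v after all. Allowing \<open>w\<close> other than 1 turns integrality into a bound on
  poles.\<close>

lemma valuation_ring_integral:
  assumes V: "valuation_ring V" and h: "h \<in> carrier R" "h \<noteq> \<zero>" and x: "x \<in> carrier R"
    and w: "w \<in> V" "w \<noteq> \<zero>" and ts: "set ts \<subseteq> carrier R" "\<And>c. c \<in> set ts \<Longrightarrow> w \<otimes> (inv h \<otimes> c) \<in> V"
    and ev: "eval (h # ts) x = \<zero>"
  shows "w \<otimes> x \<in> V"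
proof (rule ccontr)
  assume neg: "w \<otimes> x \<notin> V"
  note VE = subringE[OF valuation_ring_subring[OF V]]
  have wc: "w \<in> carrier R" using w VE by auto
  have wx: "w \<otimes> x \<in> carrier R" "w \<otimes> x \<noteq> \<zero>" using neg VE(2) wc x by auto
  define y where "y = inv (w \<otimes> x)"
  have y: "y \<in> V" "y \<in> carrier R" "y \<otimes> (w \<otimes> x) = \<one>"
    using valuation_ring_total[OF V wx] neg wx by (auto simp: y_def)
  define r where "r = y \<otimes> w"
  have r: "r \<in> V" "r \<in> carrier R" "x \<otimes> r = \<one>" using y w wc x VE(6) by (auto simp: r_def m_ac)
  have xr: "x [^] n \<otimes> r [^] n = \<one>" for n :: nat
    using r x by (metis nat_pow_distrib nat_pow_one)
  \<comment> \<open>A list of length n has degree below n, so after multiplication by the n-th power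
    of \<open>r\<close> one factor \<open>r\<close> can be pulled out.\<close>
  have claim: "\<exists>v\<in>V. w \<otimes> inv h \<otimes> eval cs x \<otimes> r [^] length cs = r \<otimes> v"
    if "set cs \<subseteq> carrier R" "\<And>c. c \<in> set cs \<Longrightarrow> w \<otimes> (inv h \<otimes> c) \<in> V" for cs
    using that
  proof (induction cs)
    case Nil
    then show ?case using VE(2) h r wc by (intro bexI[of _ \<zero>]) auto
  next
    case (Cons c cs)
    then obtain v where v: "v \<in> V" "w \<otimes> inv h \<otimes> eval cs x \<otimes> r [^] length cs = r \<otimes> v" by auto
    define Y P e where "Y = x [^] length cs" and "P = r [^] length cs" and "e = eval cs x"
    have YP: "Y \<otimes> P = \<one>" using xr by (simp add: Y_def P_def)
    have c: "Y \<in> carrier R" "P \<in> carrier R" "e \<in> carrier R" "c \<in> carrier R" "v \<in> carrier R" "inv h \<in> carrier R"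
      using x r(2) Cons.prems eval_in_carrier[OF _ x, of cs] v VE h by (auto simp: Y_def P_def e_def)
    have "w \<otimes> inv h \<otimes> eval (c # cs) x \<otimes> r [^] length (c # cs) = w \<otimes> inv h \<otimes> (c \<otimes> Y \<oplus> e) \<otimes> (P \<otimes> r)"
      by (simp add: Y_def P_def e_def)
    also have "\<dots> = r \<otimes> ((w \<otimes> (inv h \<otimes> c)) \<otimes> (Y \<otimes> P)) \<oplus> r \<otimes> (w \<otimes> inv h \<otimes> e \<otimes> P)"
      using c wc r(2) by (simp add: r_distr l_distr m_ac)
    also have "\<dots> = r \<otimes> ((w \<otimes> (inv h \<otimes> c)) \<oplus> r \<otimes> v)"
      using v(2) c wc r(2) unfolding YP by (simp add: P_def e_def r_distr)
    finally have "w \<otimes> inv h \<otimes> eval (c # cs) x \<otimes> r [^] length (c # cs) = r \<otimes> ((w \<otimes> (inv h \<otimes> c)) \<oplus> r \<otimes> v)" .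
    moreover have "(w \<otimes> (inv h \<otimes> c)) \<oplus> r \<otimes> v \<in> V" using Cons.prems v r VE(6,7) by auto
    ultimately show ?case by blast
  qed
  obtain v where v: "v \<in> V" "w \<otimes> inv h \<otimes> eval ts x \<otimes> r [^] length ts = r \<otimes> v" using claim[OF ts] by auto
  define Y P e where "Y = x [^] length ts" and "P = r [^] length ts" and "e = eval ts x"
  have YP: "Y \<otimes> P = \<one>" using xr by (simp add: Y_def P_def)
  have c: "Y \<in> carrier R" "P \<in> carrier R" "e \<in> carrier R" "v \<in> carrier R" "inv h \<in> carrier R"
    using x r(2) ts eval_in_carrier[OF _ x, of ts] v VE h by (auto simp: Y_def P_def e_def)
  have "w \<oplus> r \<otimes> v = w \<otimes> (inv h \<otimes> h) \<otimes> (Y \<otimes> P) \<oplus> w \<otimes> inv h \<otimes> e \<otimes> P"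
    unfolding YP using h wc v(2) by (simp add: P_def e_def)
  also have "\<dots> = w \<otimes> inv h \<otimes> (h \<otimes> Y \<oplus> e) \<otimes> P" using c wc h(1) by (simp add: r_distr l_distr m_ac del: l_inv r_inv)
  also have "h \<otimes> Y \<oplus> e = \<zero>" using ev by (simp add: Y_def e_def)
  finally have "w \<oplus> r \<otimes> v = \<zero>" using c wc by simp
  then have "w = \<ominus> (r \<otimes> v)" using wc r c minus_equality[of w "r \<otimes> v"] by simp
  then have "w \<otimes> x = \<ominus> (r \<otimes> v) \<otimes> x" by simp
  also have "\<dots> = \<ominus> ((x \<otimes> r) \<otimes> v)" using r(2) c x by (simp add: l_minus r_minus m_ac)
  also have "\<dots> = \<ominus> v" using r c by simp
  finally show False using neg VE(5) v by simp
qed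

corollary valuation_ring_integrally_closed:
  assumes V: "valuation_ring V" and "h \<noteq> \<zero>" "inv h \<in> V" "x \<in> carrier R" "set (h # ts) \<subseteq> V" "eval (h # ts) x = \<zero>"
  shows "x \<in> V"
proof -
  note VE = subringE[OF valuation_ring_subring[OF V]]
  have ts: "set ts \<subseteq> V" "h \<in> carrier R" "set ts \<subseteq> carrier R" using assms(5) VE(1) by auto
  have "\<one> \<otimes> (inv h \<otimes> c) \<in> V" if "c \<in> set ts" for c using VE(1,3,6) assms(3) that ts(1) by blast
  then have "\<one> \<otimes> x \<in> V"
    by (intro valuation_ring_integral[OF V ts(2) assms(2,4) VE(3) one_not_zero ts(3) _ assms(6)])
  then show ?thesis using assms by simp
qed

text \<open>The integral closure of \<open>E[Q]\<close>, described by valuations: \<open>z\<close> belongs to it if its poles are bounded,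
  uniformly in the valuation ring, by a power of the poles of \<open>Q\<close>. The scaling factor \<open>v\<close> cancels the poles of \<open>Q\<close>,
  so that \<open>v = 1\<close> yields integrality at all valuation rings containing \<open>E\<close> and \<open>Q\<close>, and \<open>v = u\<^sup>-\<^sup>1\<close> a bound on the
  order of growth at a pole of \<open>u\<close>.\<close>

definition scales :: "'a set \<Rightarrow> 'a set \<Rightarrow> 'a set \<Rightarrow> 'a \<Rightarrow> bool" where
  "scales E Q V v \<longleftrightarrow> valuation_ring V \<and> E \<subseteq> V \<and> v \<in> V \<and> v \<noteq> \<zero> \<and> (\<forall>q\<in>Q. v \<otimes> q \<in> V)"

definition integral_hull :: "'a set \<Rightarrow> 'a set \<Rightarrow> 'a set" where
  "integral_hull E Q = {z \<in> carrier R. \<exists>s::nat. \<forall>V v. scales E Q V v \<longrightarrow> v [^] s \<otimes> z \<in> V}"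

lemma scales_carrier: "scales E Q V v \<Longrightarrow> v \<in> carrier R"
  using subringE(1)[OF valuation_ring_subring] by (auto simp: scales_def)

lemma scales_pow:
  assumes "scales E Q V v" shows "v [^] (n::nat) \<in> V" "v [^] n \<noteq> \<zero>" "v [^] n \<in> carrier R"
  using assms nat_pow_in_subring[OF valuation_ring_subring] scales_carrier[OF assms] by (auto simp: scales_def)

lemma scales_lift:
  assumes "scales E Q V v" "v [^] (s::nat) \<otimes> z \<in> V" "s \<le> s'" "z \<in> carrier R"
  shows "v [^] s' \<otimes> z \<in> V"
proof -
  have "v [^] s' \<otimes> z = v [^] (s' - s) \<otimes> (v [^] s \<otimes> z)"
    using assms scales_carrier[OF assms(1)] by (simp flip: m_assoc add: nat_pow_mult)
  then show ?thesis
    using subringE(6)[OF valuation_ring_subring _ assms(2)] scales_pow[OF assms(1)] assms(1) by (simp add: scales_def)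
qed

lemma integral_hull_common_exponent:
  assumes "finite Y" "Y \<subseteq> integral_hull E Q"
  obtains s :: nat where "\<And>V v x. scales E Q V v \<Longrightarrow> x \<in> Y \<Longrightarrow> v [^] s \<otimes> x \<in> V"
proof -
  have "\<forall>x\<in>Y. \<exists>s::nat. \<forall>V v. scales E Q V v \<longrightarrow> v [^] s \<otimes> x \<in> V" using assms by (auto simp: integral_hull_def)
  then obtain f :: "'a \<Rightarrow> nat" where f: "\<forall>x\<in>Y. \<forall>V v. scales E Q V v \<longrightarrow> v [^] f x \<otimes> x \<in> V" by metis
  have "f x \<le> (\<Sum>x\<in>Y. f x)" if "x \<in> Y" for x using assms(1) that by (simp add: member_le_sum)
  then have "v [^] (\<Sum>x\<in>Y. f x) \<otimes> x \<in> V" if "scales E Q V v" "x \<in> Y" for V v x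
    using scales_lift[OF that(1), of "f x" x] f assms(2) that by (auto simp: integral_hull_def)
  then show ?thesis by (rule that)
qed

lemma integral_hull_base: "E \<subseteq> carrier R \<Longrightarrow> E \<subseteq> integral_hull E Q"
proof
  fix x assume "E \<subseteq> carrier R" "x \<in> E"
  then have "x \<in> carrier R" "v [^] (0::nat) \<otimes> x \<in> V" if "scales E Q V v" for V v
    using that by (auto simp: scales_def subset_iff)
  then show "x \<in> integral_hull E Q" using \<open>x \<in> E\<close> \<open>E \<subseteq> carrier R\<close> unfolding integral_hull_def by blast
qed

lemma integral_hull_gen: "Q \<subseteq> carrier R \<Longrightarrow> Q \<subseteq> integral_hull E Q"
  by (auto simp: integral_hull_def intro!: exI[of _ "Suc 0"]) (simp_all add: scales_carrier, simp add: scales_def)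

lemma integral_hull_subring: "subring (integral_hull E Q) R"
proof (rule subringI)
  show "integral_hull E Q \<subseteq> carrier R" by (auto simp: integral_hull_def)
  have V: "subring V R" if "scales E Q V v" for V v using that valuation_ring_subring by (auto simp: scales_def)
  show "\<one> \<in> integral_hull E Q" using subringE(3)[OF V] by (auto simp: integral_hull_def intro!: exI[of _ 0])
  fix x assume x: "x \<in> integral_hull E Q"
  then have xc: "x \<in> carrier R" by (auto simp: integral_hull_def)
  obtain s :: nat where s: "\<And>V v. scales E Q V v \<Longrightarrow> v [^] s \<otimes> x \<in> V" using x by (auto simp: integral_hull_def)
  have "v [^] s \<otimes> (\<ominus> x) \<in> V" if "scales E Q V v" for V v
    using subringE(5)[OF V[OF that] s[OF that]] xc scales_pow(3)[OF that] by (simp add: r_minus)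
  then show "\<ominus> x \<in> integral_hull E Q" using xc by (auto simp: integral_hull_def)
  fix y assume y: "y \<in> integral_hull E Q"
  then have yc: "y \<in> carrier R" by (auto simp: integral_hull_def)
  obtain s' :: nat where s': "\<And>V v. scales E Q V v \<Longrightarrow> v [^] s' \<otimes> y \<in> V" using y by (auto simp: integral_hull_def)
  have "v [^] (s + s') \<otimes> (x \<otimes> y) \<in> V" if sc: "scales E Q V v" for V v
  proof -
    have "v [^] (s + s') \<otimes> (x \<otimes> y) = (v [^] s \<otimes> x) \<otimes> (v [^] s' \<otimes> y)"
      using xc yc scales_pow(3)[OF sc] scales_carrier[OF sc] by (simp flip: nat_pow_mult add: m_ac)
    then show ?thesis using subringE(6)[OF V[OF sc] s[OF sc] s'[OF sc]] by simp
  qed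
  then show "x \<otimes> y \<in> integral_hull E Q" using xc yc by (auto simp: integral_hull_def)
  have "v [^] (s + s') \<otimes> (x \<oplus> y) \<in> V" if sc: "scales E Q V v" for V v
  proof -
    have "v [^] (s + s') \<otimes> (x \<oplus> y) = v [^] (s + s') \<otimes> x \<oplus> v [^] (s + s') \<otimes> y"
      using xc yc scales_pow(3)[OF sc] by (simp add: r_distr)
    moreover have "v [^] (s + s') \<otimes> x \<in> V" "v [^] (s + s') \<otimes> y \<in> V"
      using scales_lift[OF sc s[OF sc]] scales_lift[OF sc s'[OF sc]] xc yc by auto
    ultimately show ?thesis using subringE(7)[OF V[OF sc]] by simp
  qed
  then show "x \<oplus> y \<in> integral_hull E Q" using xc yc by (auto simp: integral_hull_def)
qed

text \<open>A common exponent for the quotients of the coefficients by the leading one serves for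
  the root as well: in each valuation ring the power of \<open>v\<close> is the factor
  \<open>w\<close> of \<open>valuation_ring_integral\<close>.\<close>

lemma integral_hull_integrally_closed:
  assumes "h \<in> carrier R" "h \<noteq> \<zero>" "inv h \<in> integral_hull E Q" "set ts \<subseteq> integral_hull E Q" "x \<in> carrier R"
    "eval (h # ts) x = \<zero>"
  shows "x \<in> integral_hull E Q"
proof -
  note H = subringE[OF integral_hull_subring[of E Q]]
  have "finite ((\<lambda>c. inv h \<otimes> c) ` set ts)" "(\<lambda>c. inv h \<otimes> c) ` set ts \<subseteq> integral_hull E Q"
    using assms H(6) by auto
  then obtain s :: nat where s: "\<And>V v x. scales E Q V v \<Longrightarrow> x \<in> (\<lambda>c. inv h \<otimes> c) ` set ts \<Longrightarrow> v [^] s \<otimes> x \<in> V"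
    using integral_hull_common_exponent by blast
  have "v [^] s \<otimes> x \<in> V" if sc: "scales E Q V v" for V v
    by (rule valuation_ring_integral[OF _ assms(1,2,5) _ _ _ _ assms(6)])
      (use sc s scales_pow[OF sc] assms(4) H(1) in \<open>auto simp: scales_def\<close>)
  then show ?thesis using assms(5) by (auto simp: integral_hull_def)
qed

lemma integral_hull_mono:
  assumes "finite Q" "Q \<subseteq> integral_hull E Q'"
  shows "integral_hull E Q \<subseteq> integral_hull E Q'"
proof
  obtain s :: nat where s: "\<And>V v x. scales E Q' V v \<Longrightarrow> x \<in> Q \<Longrightarrow> v [^] s \<otimes> x \<in> V"
    using integral_hull_common_exponent[OF assms] by blast
  fix x assume x: "x \<in> integral_hull E Q"
  then obtain k :: nat where k: "\<And>V v. scales E Q V v \<Longrightarrow> v [^] k \<otimes> x \<in> V" by (auto simp: integral_hull_def)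
  have "v [^] (s * k) \<otimes> x \<in> V" if sc: "scales E Q' V v" for V v
  proof -
    have "scales E Q V (v [^] s)" using sc s[OF sc] scales_pow[OF sc] by (auto simp: scales_def)
    then show ?thesis using k[of V "v [^] s"] scales_carrier[OF sc] by (simp add: nat_pow_pow)
  qed
  then show "x \<in> integral_hull E Q'" using x by (auto simp: integral_hull_def)
qed

lemma algebraic_listE:
  assumes "subring D R" "x \<in> carrier R" "(algebraic over D) x"
  obtains h ts where "h \<noteq> \<zero>" "set (h # ts) \<subseteq> D" "eval (h # ts) x = \<zero>"
proof -
  obtain p where p: "p \<in> carrier (D [X])" "p \<noteq> []" "eval p x = \<zero>" using algebraicE[OF assms] .
  then obtain h ts where "p = h # ts" by (cases p) auto
  then show ?thesis using p that by (auto simp: univ_poly_def polynomial_def)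
qed

lemma algebraic_listI:
  assumes "h \<noteq> \<zero>" "set (h # ts) \<subseteq> D" "eval (h # ts) x = \<zero>"
  shows "(algebraic over D) x"
  by (rule algebraicI[of "h # ts"]) (use assms in \<open>auto simp: univ_poly_def polynomial_def\<close>)

lemma simple_extension_evalE:
  assumes "subring D R" "x \<in> carrier R" "z \<in> simple_extension D x"
  obtains p where "p \<in> carrier (D [X])" "set p \<subseteq> D" "z = eval p x"
proof -
  obtain p where p: "p \<in> carrier (D [X])" "z = eval p x"
    using assms simple_extension_as_eval_img[of D x] subringE(1) by blast
  then have "set p \<subseteq> D" by (auto simp: univ_poly_def polynomial_def)
  then show ?thesis using that p by blast
qed

section \<open>Integral hulls over E[t] with one denominator inverted\<close>

context
  fixes E :: "'a set" and t :: 'a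
  assumes E: "subring E R" and t: "t \<in> carrier R"
begin

lemma simple_extension_le_integral_hull: "t \<in> Q \<Longrightarrow> Q \<subseteq> carrier R \<Longrightarrow> simple_extension E t \<subseteq> integral_hull E Q"
  by (rule simple_extension_subring_incl[OF integral_hull_subring])
    (use integral_hull_base[OF subringE(1)[OF E]] subsetD[OF integral_hull_gen] in auto)

lemma integral_hull_mult_denom:
  assumes "N \<in> simple_extension E t - {\<zero>}" "M \<in> simple_extension E t - {\<zero>}"
  shows "integral_hull E {t, inv N} \<subseteq> integral_hull E {t, inv (N \<otimes> M)}"
proof (rule integral_hull_mono)
  have c: "N \<in> carrier R" "M \<in> carrier R" "N \<noteq> \<zero>" "M \<noteq> \<zero>"
    using assms simple_extension_in_carrier[OF subringE(1)[OF E] t] by auto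
  let ?H = "integral_hull E {t, inv (N \<otimes> M)}"
  have cc: "{t, inv (N \<otimes> M)} \<subseteq> carrier R" using t c by (auto simp: integral_iff)
  have "M \<in> ?H" "inv (N \<otimes> M) \<in> ?H" "t \<in> ?H"
    using simple_extension_le_integral_hull[OF _ cc] integral_hull_gen[OF cc] assms by auto
  moreover have "inv N = M \<otimes> inv (N \<otimes> M)" using c by (simp add: nonzero_inverse_mult_distrib integral_iff flip: m_assoc)
  ultimately show "{t, inv N} \<subseteq> ?H" using subringE(6)[OF integral_hull_subring] by auto
qed auto

lemma integral_hull_common_denom:
  assumes "finite Y" "\<And>x. x \<in> Y \<Longrightarrow> \<exists>N\<in>simple_extension E t - {\<zero>}. x \<in> integral_hull E {t, inv N}"
  shows "\<exists>N\<in>simple_extension E t - {\<zero>}. Y \<subseteq> integral_hull E {t, inv N}"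
  using assms
proof (induction Y)
  case empty
  then show ?case using subringE(3)[OF simple_extension_is_subring[OF E t]] by auto
next
  case (insert x Y)
  then obtain N M where *: "N \<in> simple_extension E t - {\<zero>}" "M \<in> simple_extension E t - {\<zero>}"
    "x \<in> integral_hull E {t, inv N}" "Y \<subseteq> integral_hull E {t, inv M}" by (metis insertCI)
  have c: "N \<in> carrier R" "M \<in> carrier R" "N \<noteq> \<zero>" "M \<noteq> \<zero>"
    using * simple_extension_in_carrier[OF subringE(1)[OF E] t] by auto
  have "N \<otimes> M \<in> simple_extension E t - {\<zero>}"
    using * c subringE(6)[OF simple_extension_is_subring[OF E t]] by (simp add: integral_iff)
  moreover have "insert x Y \<subseteq> integral_hull E {t, inv (N \<otimes> M)}"
    using integral_hull_mult_denom[OF *(1,2)] integral_hull_mult_denom[OF *(2,1)] * c by (auto simp: m_comm)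
  ultimately show ?case by blast
qed

lemma algebraic_imp_integral_hull:
  assumes "z \<in> carrier R" "(algebraic over (simple_extension E t)) z"
  shows "\<exists>N\<in>simple_extension E t - {\<zero>}. z \<in> integral_hull E {t, inv N}"
proof -
  obtain h ts where h: "h \<noteq> \<zero>" "set (h # ts) \<subseteq> simple_extension E t" "eval (h # ts) z = \<zero>"
    using algebraic_listE[OF simple_extension_is_subring[OF E t] assms] .
  have hc: "h \<in> carrier R" using simple_extension_in_carrier[OF subringE(1)[OF E] t] h by auto
  then have cc: "{t, inv h} \<subseteq> carrier R" using h t by auto
  have "set ts \<subseteq> integral_hull E {t, inv h}" using simple_extension_le_integral_hull[OF _ cc] h by auto
  then have "z \<in> integral_hull E {t, inv h}"
    using integral_hull_integrally_closed[OF hc h(1) _ _ assms(1) h(3)] integral_hull_gen[OF cc] by auto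
  then show ?thesis using h by auto
qed

text \<open>The coefficients of an equation over \<open>F\<close>, and the inverse of the leading
  one, are algebraic over E[t] and hence share a denominator. That the hull is integrally closed
  then takes care of the root, which supplies the transitivity of algebraicity.\<close>

lemma algebraic_trans_imp_integral_hull:
  assumes F: "subfield F R" "\<And>z. z \<in> F \<Longrightarrow> (algebraic over (simple_extension E t)) z" and Y: "finite Y" "Y \<subseteq> carrier R"
    "\<And>x. x \<in> Y \<Longrightarrow> (algebraic over F) x"
  shows "\<exists>N\<in>simple_extension E t - {\<zero>}. Y \<subseteq> integral_hull E {t, inv N}"
proof (rule integral_hull_common_denom[OF Y(1)])
  fix x assume x: "x \<in> Y"
  note FE = subringE[OF subfieldE(1)[OF F(1)]]
  obtain h ts where h: "h \<noteq> \<zero>" "set (h # ts) \<subseteq> F" "eval (h # ts) x = \<zero>"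
    using algebraic_listE[OF subfieldE(1)[OF F(1)]] Y x by blast
  have "inv h \<in> F" using subfield_m_inv[OF F(1)] h by auto
  then have "insert (inv h) (set ts) \<subseteq> F" using h by auto
  then obtain N where N: "N\<in>simple_extension E t - {\<zero>}" "insert (inv h) (set ts) \<subseteq> integral_hull E {t, inv N}"
    using integral_hull_common_denom[of "insert (inv h) (set ts)"] algebraic_imp_integral_hull F(2) FE(1) by blast
  then have "x \<in> integral_hull E {t, inv N}"
    using integral_hull_integrally_closed[OF _ h(1) _ _ _ h(3)] h(2) FE(1) Y(2) x by auto
  then show "\<exists>N\<in>simple_extension E t - {\<zero>}. x \<in> integral_hull E {t, inv N}" using N by auto
qed

end

text \<open>Chevalley's theorem applied to \<open>B\<close> with \<open>inv z\<close> adjoined: were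
  \<open>z\<close> missing there, some valuation ring above \<open>B\<close> would avoid it. The
  conclusion expresses that \<open>z\<close> is integral over \<open>B\<close>.\<close>

lemma mem_simple_extension_inv:
  assumes "subring B R" "z \<in> carrier R" "z \<noteq> \<zero>" "\<And>V. valuation_ring V \<Longrightarrow> B \<subseteq> V \<Longrightarrow> z \<in> V"
  shows "z \<in> simple_extension B (inv z)"
proof (rule ccontr)
  assume neg: "z \<notin> simple_extension B (inv z)"
  have iz: "inv z \<in> carrier R" using assms by simp
  note S = simple_extension_is_subring[OF assms(1) iz] simple_extension_mem[OF assms(1) iz]
    simple_extension_incl[OF subringE(1)[OF assms(1)] iz]
  obtain V where "valuation_ring V" "simple_extension B (inv z) \<subseteq> V" "z \<notin> V"
    using exists_valuation_ring[OF S(1) assms(2,3) S(2) neg] by blast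
  then show False using assms(4) S(3) by blast
qed

lemma algebraic_inv:
  assumes "subfield E R" "t \<in> carrier R" "t \<noteq> \<zero>"
  shows "(algebraic over E) (inv t) \<longleftrightarrow> (algebraic over E) t"
proof -
  have 1: "(algebraic over E) (inv s)" if "s \<in> carrier R" "s \<noteq> \<zero>" "(algebraic over E) s" for s
    using subfield_m_inv(1)[OF subfield_of_algebraics[OF assms(1)], of s] that by auto
  show ?thesis using 1[of t] 1[of "inv t"] assms nonzero_imp_inverse_nonzero nonzero_inverse_inverse_eq by auto
qed

text \<open>From z = p(1/z) it follows that \<open>inv z\<close> is a root of X p(X) - 1, whose
  coefficient list is \<open>p\<close> followed by - 1.\<close>

lemma algebraic_if_mem_simple_extension_inv:
  assumes B: "subring B R" and z: "z \<in> carrier R" "z \<noteq> \<zero>" "z \<in> simple_extension B (inv z)"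
  shows "(algebraic over B) (inv z)"
proof -
  note B' = subringE[OF B]
  obtain p where p: "p \<in> carrier (B [X])" "set p \<subseteq> B" "z = eval p (inv z)"
    using simple_extension_evalE[OF B inv_closed[OF z(1,2)] z(3)] by metis
  then obtain h ts where hts: "p = h # ts" using z by (cases p) auto
  have "eval (p @ [\<ominus> \<one>]) (inv z) = eval p (inv z) \<otimes> inv z \<oplus> \<ominus> \<one>"
    using p B'(1) z by (intro eval_append_aux) auto
  also have "\<dots> = \<zero>" using z p(3) by (metis r_inv r_neg one_closed)
  finally show ?thesis
    using algebraic_listI[of h "ts @ [\<ominus> \<one>]"] p hts B' by (auto simp: univ_poly_def polynomial_def)
qed

text \<open>If \<open>t\<close> lies in all valuation rings above \<open>E\<close>, the integrality
  criterion makes it algebraic. Conversely, over a field every equation can be made monic, and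
  valuation rings are integrally closed.\<close>

lemma transcendental_iff_valuation_ring:
  assumes E: "subfield E R" and t: "t \<in> carrier R"
  shows "(transcendental over E) t \<longleftrightarrow> (\<exists>V. valuation_ring V \<and> E \<subseteq> V \<and> t \<notin> V)"
proof
  note E' = subfieldE(1)[OF E] subringE[OF subfieldE(1)[OF E]]
  show "\<exists>V. valuation_ring V \<and> E \<subseteq> V \<and> t \<notin> V" if tr: "(transcendental over E) t"
  proof (rule ccontr)
    assume neg: "\<not> ?thesis"
    have t0: "t \<noteq> \<zero>" using tr zero_is_algebraic[OF E'(1)] by (auto simp: over_def)
    then have "t \<in> simple_extension E (inv t)" using mem_simple_extension_inv[OF E'(1) t] neg by blast
    then have "(algebraic over E) (inv t)" by (rule algebraic_if_mem_simple_extension_inv[OF E'(1) t t0])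
    then show False using algebraic_inv[OF E t t0] tr by (auto simp: over_def)
  qed
  show "(transcendental over E) t" if ex: "\<exists>V. valuation_ring V \<and> E \<subseteq> V \<and> t \<notin> V"
  proof (rule ccontr)
    assume "\<not> (transcendental over E) t"
    then have "(algebraic over E) t" by (simp add: over_def)
    then obtain h ts where h: "h \<noteq> \<zero>" "set (h # ts) \<subseteq> E" "eval (h # ts) t = \<zero>" using algebraic_listE[OF E'(1) t] by blast
    obtain V where V: "valuation_ring V" "E \<subseteq> V" "t \<notin> V" using ex by blast
    have "inv h \<in> E" using subfield_m_inv[OF E] h by auto
    then show False using valuation_ring_integrally_closed[OF V(1) h(1) _ t _ h(3)] h(2) V by auto
  qed
qed

text \<open>No valuation ring above \<open>E\<close> is both a pole of \<open>t\<close> and a zero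
  of \<open>N\<close>. If \<open>N\<close> lies in \<open>V\<close>, then \<open>t\<close> is a root
  of p - N, whose leading coefficient is a unit coming from \<open>E\<close>, so \<open>t\<close> is
  integral over \<open>V\<close>, unless \<open>N\<close> is itself a constant and thus a
  unit.\<close>

lemma valuation_ring_gen_or_denom:
  assumes E: "subfield E R" and t: "t \<in> carrier R" and N: "N \<in> simple_extension E t" "N \<noteq> \<zero>"
    and V: "valuation_ring V" "E \<subseteq> V"
  shows "t \<in> V \<or> inv N \<in> V"
proof (rule ccontr)
  assume neg: "\<not> ?thesis"
  note E' = subfieldE(1)[OF E] subringE[OF subfieldE(1)[OF E]]
  note VE = subringE[OF valuation_ring_subring[OF V(1)]]
  have Nc: "N \<in> carrier R" using N simple_extension_in_carrier[OF E'(2) t] by auto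
  have NV: "N \<in> V" using neg valuation_ring_total[OF V(1) Nc N(2)] by auto
  obtain p where p: "p \<in> carrier (E [X])" "set p \<subseteq> E" "N = eval p t" using simple_extension_evalE[OF E'(1) t N(1)] .
  then obtain h ts where hts: "p = h # ts" using N by (cases p) auto
  have h: "h \<in> E" "h \<noteq> \<zero>" "inv h \<in> E" "h \<in> carrier R"
    using p hts subfield_m_inv[OF E, of h] E'(2) by (auto simp: univ_poly_def polynomial_def)
  show False
  proof (cases "ts = []")
    case True
    then have "N = h" using p hts h by simp
    then show False using neg h V by auto
  next
    case False
    then obtain us l where us: "ts = us @ [l]" by (metis rev_exhaust)
    have c: "set (h # us) \<subseteq> carrier R" "l \<in> carrier R" using p hts us E'(2) by auto
    have e: "eval (h # us) t \<in> carrier R" by (rule eval_in_carrier[OF c(1) t])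
    have "eval ((h # us) @ [l \<ominus> N]) t = eval (h # us) t \<otimes> t \<oplus> (l \<ominus> N)"
      using c Nc t by (intro eval_append_aux) auto
    also have "\<dots> = (eval (h # us) t \<otimes> t \<oplus> l) \<ominus> N" using e c Nc t by (simp add: minus_eq a_assoc)
    also have "eval (h # us) t \<otimes> t \<oplus> l = N" using eval_append_aux[OF c t] p hts us by simp
    also have "N \<ominus> N = \<zero>" using Nc by simp
    finally have "eval (h # (us @ [l \<ominus> N])) t = \<zero>" by simp
    moreover have "l \<ominus> N \<in> V" using subring_minus_closed[OF valuation_ring_subring[OF V(1)] _ NV] p hts us V by auto
    ultimately have "t \<in> V" using valuation_ring_integrally_closed[OF V(1) h(2) _ t, of "us @ [l \<ominus> N]"] p hts us V h by auto
    then show False using neg by blast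
  qed
qed


section \<open>Separating valuations\<close>

text \<open>The difference a - c inherits every pole of \<open>u\<close>, and \<open>u\<close> has
  one because \<open>t\<close> has; so a - c is transcendental over \<open>E\<close> and its inverse
  has a pole somewhere. There a - c has no pole, hence neither has \<open>u\<close>, hence neither
  have \<open>t\<close> and \<open>inv N\<close>, and the whole integral hull is contained in that
  valuation ring, in particular \<open>Z\<close> and the inverses of its elements.\<close>

lemma separating_valuation_ring_transcendental:
  assumes E: "subfield E R" and F: "subfield F R" "E \<subseteq> F" and t: "t \<in> F" "(transcendental over E) t"
    and alg: "\<And>z. z \<in> F \<Longrightarrow> (algebraic over (simple_extension E t)) z"
    and a: "a \<in> carrier R" "(algebraic over F) a"
    and Z: "finite Z" "Z \<subseteq> carrier R - {\<zero>}" "\<And>z. z \<in> Z \<Longrightarrow> (algebraic over F) z"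
  shows "\<exists>c\<in>F. \<exists>V. valuation_ring V \<and> E \<subseteq> V \<and> a \<noteq> c \<and> inv (a \<ominus> c) \<notin> V \<and> (\<forall>z\<in>Z. z \<in> V \<and> inv z \<in> V)"
proof -
  note ES = subfieldE(1)[OF E]
  note FE = subringE[OF subfieldE(1)[OF F(1)]]
  have tc: "t \<in> carrier R" using t FE by auto
  let ?Y = "insert a (Z \<union> m_inv R ` Z)"
  have "(algebraic over F) x" if "x \<in> ?Y" for x
    using that a Z algebraic_inv[OF F(1)] by auto
  moreover have "finite ?Y" "?Y \<subseteq> carrier R" using Z a inv_closed by blast+
  ultimately obtain N where N: "N \<in> simple_extension E t - {\<zero>}" and Y: "?Y \<subseteq> integral_hull E {t, inv N}"
    using algebraic_trans_imp_integral_hull[OF ES tc F(1) alg] by meson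
  have Nc: "N \<in> carrier R" "N \<noteq> \<zero>" using N simple_extension_in_carrier[OF subringE(1)[OF ES] tc] by auto
  have iN: "inv N \<in> carrier R" using Nc by simp
  have NF: "N \<in> F" using simple_extension_subring_incl[OF subfieldE(1)[OF F(1)] F(2) t(1)] N by auto
  \<comment> \<open>At valuation rings above \<open>E\<close> the summands have no common pole, so
    each pole of either one is a pole of the sum, without cancellation.\<close>
  define u where "u = t \<oplus> inv N"
  have u: "u \<in> carrier R" using tc iN by (simp add: u_def)
  have uF: "u \<in> F" using t NF subfield_m_inv(1)[OF F(1), of N] Nc FE(7) by (auto simp: u_def)
  have bounded: "t \<in> V \<and> inv N \<in> V" if V: "valuation_ring V" "E \<subseteq> V" "u \<in> V" for V
  proof -
    have "t = u \<ominus> inv N" "inv N = u \<ominus> t" unfolding u_def using tc iN by algebra+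
    then show ?thesis
      using valuation_ring_gen_or_denom[OF E tc _ Nc(2) V(1,2)] N V(3) subring_minus_closed[OF valuation_ring_subring[OF V(1)]]
      by (metis DiffD1)
  qed
  obtain V0 where V0: "valuation_ring V0" "E \<subseteq> V0" "u \<notin> V0"
    using t(2) bounded transcendental_iff_valuation_ring[OF E tc] by blast
  obtain s :: nat where s: "\<And>V v x. scales E {t, inv N} V v \<Longrightarrow> x \<in> ?Y \<Longrightarrow> v [^] s \<otimes> x \<in> V"
    using integral_hull_common_exponent[OF _ Y] \<open>finite ?Y\<close> by metis
  \<comment> \<open>\<open>s\<close> bounds the order of the pole of \<open>a\<close> in terms of
    that of \<open>u\<close>; the exponent \<open>Suc s\<close> makes the pole of \<open>c\<close>
    dominate.\<close>
  define c where "c = u [^] Suc s"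
  have c: "c \<in> carrier R" "c \<in> F" using u nat_pow_in_subring[OF subfieldE(1)[OF F(1)] uF, of "Suc s"] unfolding c_def by (simp_all del: nat_pow_Suc)
  have pole: "a \<ominus> c \<notin> V" if V: "valuation_ring V" "E \<subseteq> V" "u \<notin> V" for V
  proof
    assume ac: "a \<ominus> c \<in> V"
    note VE = subringE[OF valuation_ring_subring[OF V(1)]]
    have u0: "u \<noteq> \<zero>" using V VE(2) by auto
    define v where "v = inv u"
    have v: "v \<in> V" "v \<in> carrier R" "v \<noteq> \<zero>" "v \<otimes> u = \<one>"
      using valuation_ring_total[OF V(1) u u0] V(3) u u0 nonzero_imp_inverse_nonzero by (auto simp: v_def)
    have "v \<otimes> t \<oplus> v \<otimes> inv N = \<one>" using v tc iN by (simp add: u_def r_distr)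
    then have "v \<otimes> t = \<one> \<ominus> v \<otimes> inv N" "v \<otimes> inv N = \<one> \<ominus> v \<otimes> t" using v tc iN
      by (metis add.inv_solve_right' minus_eq m_closed one_closed, metis a_comm add.inv_solve_right' minus_eq m_closed one_closed)
    moreover have "t \<in> V \<or> inv N \<in> V" using valuation_ring_gen_or_denom[OF E tc _ Nc(2) V(1,2)] N by auto
    ultimately have "v \<otimes> t \<in> V" "v \<otimes> inv N \<in> V"
      using v(1) VE(3,6) subring_minus_closed[OF valuation_ring_subring[OF V(1)]] by metis+
    then have "scales E {t, inv N} V v" using V v by (auto simp: scales_def)
    then have sa: "v [^] s \<otimes> a \<in> V" using s by blast
    have vs: "v [^] s \<in> V" using nat_pow_in_subring[OF valuation_ring_subring[OF V(1)] v(1)] .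
    have vu: "v [^] Suc s \<otimes> c = \<one>" using v u unfolding c_def by (metis nat_pow_distrib nat_pow_one)
    define A where "A = v [^] s"
    have A: "A \<in> V" "A \<in> carrier R" using vs VE(1) by (auto simp: A_def)
    have "v \<otimes> (A \<otimes> a) \<ominus> v \<otimes> (A \<otimes> (a \<ominus> c)) = v \<otimes> A \<otimes> c" using v(2) A(2) a(1) c(1) by algebra
    also have "\<dots> = \<one>" using vu v A c unfolding A_def nat_pow_Suc by (simp add: m_comm)
    finally have "\<one> = v \<otimes> (A \<otimes> a \<ominus> A \<otimes> (a \<ominus> c))" using v(2) A(2) a(1) c(1) by algebra
    then have "u \<otimes> \<one> = u \<otimes> (v \<otimes> (A \<otimes> a \<ominus> A \<otimes> (a \<ominus> c)))" by simp
    also have "\<dots> = (v \<otimes> u) \<otimes> (A \<otimes> a \<ominus> A \<otimes> (a \<ominus> c))" using v(2) u A(2) a(1) c(1) by algebra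
    finally have "u = A \<otimes> a \<ominus> A \<otimes> (a \<ominus> c)" using v(4) u A(2) a(1) c(1) by simp
    also have "\<dots> \<in> V" using sa ac A(1) VE(6) subring_minus_closed[OF valuation_ring_subring[OF V(1)]] by (simp add: A_def)
    finally show False using V(3) by simp
  qed
  have acc: "a \<ominus> c \<in> carrier R" using a c by simp
  have ac0: "a \<ominus> c \<noteq> \<zero>" using pole[OF V0] subringE(2)[OF valuation_ring_subring[OF V0(1)]] by auto
  then have "a \<noteq> c" using a c by (metis r_right_minus_eq)
  have "(transcendental over E) (a \<ominus> c)" using transcendental_iff_valuation_ring[OF E acc] V0 pole[OF V0] by blast
  then have "(transcendental over E) (inv (a \<ominus> c))" using algebraic_inv[OF E acc ac0] by (auto simp: over_def)
  then obtain V where V: "valuation_ring V" "E \<subseteq> V" "inv (a \<ominus> c) \<notin> V"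
    using transcendental_iff_valuation_ring[OF E] acc ac0 by auto
  then have "a \<ominus> c \<in> V" using valuation_ring_total[OF V(1) acc ac0] by auto
  then have "u \<in> V" using pole[OF V(1,2)] by blast
  then have b: "t \<in> V" "inv N \<in> V" using bounded[OF V(1,2)] by auto
  note VE = subringE[OF valuation_ring_subring[OF V(1)]]
  have "scales E {t, inv N} V \<one>" using V b VE by (auto simp: scales_def)
  then have "\<one> [^] s \<otimes> x \<in> V" if "x \<in> ?Y" for x using s that by blast
  moreover have "?Y \<subseteq> carrier R" using Z a inv_closed by blast
  ultimately have "x \<in> V" if "x \<in> ?Y" for x using that by (metis l_one nat_pow_one subsetD)
  then have "\<forall>z\<in>Z. z \<in> V \<and> inv z \<in> V" by auto
  then show ?thesis using c V \<open>a \<noteq> c\<close> by blast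
qed

section \<open>Clearing denominators and exchanging transcendental elements\<close>

lemma eval_scale:
  assumes "set p \<subseteq> carrier R" "k \<in> carrier R" "x \<in> carrier R"
  shows "eval (map ((\<otimes>) k) p) x = k \<otimes> eval p x"
  using assms(1)
proof (induction p)
  case (Cons c p)
  then have "eval p x \<in> carrier R" using eval_in_carrier assms by auto
  then show ?case using Cons assms by (simp add: r_distr m_assoc)
qed (use assms in auto)

lemma simple_extension_inv_common_denom:
  assumes "subring V R" "e \<in> V" "e \<noteq> \<zero>" "set p \<subseteq> simple_extension V (inv e)"
  shows "\<exists>n::nat. \<forall>c\<in>set p. e [^] n \<otimes> c \<in> V"
  using assms(4)
proof (induction p)
  case (Cons c p)
  note VE = subringE[OF assms(1)]
  have e: "e \<in> carrier R" "inv e \<in> carrier R" using VE assms by auto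
  obtain n m :: nat where nm: "\<forall>c\<in>set p. e [^] n \<otimes> c \<in> V" "e [^] m \<otimes> c \<in> V"
    using Cons mem_simple_extension_inv_denom[OF assms(1-3)] by force
  have "e [^] (n + m) \<otimes> d \<in> V" if dd: "d \<in> set (c # p)" for d
  proof -
    have d: "d \<in> carrier R" using dd Cons.prems simple_extension_in_carrier[OF VE(1) e(2)] by auto
    have eq: "e [^] (n + m) \<otimes> d = e [^] m \<otimes> (e [^] n \<otimes> d)" "e [^] (n + m) \<otimes> d = e [^] n \<otimes> (e [^] m \<otimes> d)"
      using e d by (simp_all flip: nat_pow_mult add: m_ac)
    consider "d \<in> set p" | "d = c" using dd by auto
    then show ?thesis
    proof cases
      case 1
      then show ?thesis unfolding eq(1) using nm VE(6) nat_pow_in_subring[OF assms(1,2)] by blast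
    next
      case 2
      then show ?thesis unfolding eq(2) using nm VE(6) nat_pow_in_subring[OF assms(1,2)] by blast
    qed
  qed
  then show ?case by blast
qed auto

lemma algebraic_over_simple_extension_inv:
  assumes V: "subring V R" "e \<in> V" "e \<noteq> \<zero>" and x: "x \<in> carrier R" "(algebraic over (simple_extension V (inv e))) x"
  shows "(algebraic over V) x"
proof -
  note VE = subringE[OF V(1)]
  have e: "e \<in> carrier R" "inv e \<in> carrier R" using VE V by auto
  obtain h ts where h: "h \<noteq> \<zero>" "set (h # ts) \<subseteq> simple_extension V (inv e)" "eval (h # ts) x = \<zero>"
    using algebraic_listE[OF simple_extension_is_subring[OF V(1) e(2)] x] .
  obtain n :: nat where n: "\<forall>c\<in>set (h # ts). e [^] n \<otimes> c \<in> V"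
    using simple_extension_inv_common_denom[OF V h(2)] by blast
  have hc: "set (h # ts) \<subseteq> carrier R" using h(2) simple_extension_in_carrier[OF VE(1) e(2)] by blast
  have k: "e [^] n \<in> carrier R" "e [^] n \<noteq> \<zero>" using e V by auto
  have "eval (map ((\<otimes>) (e [^] n)) (h # ts)) x = \<zero>" using eval_scale[OF hc k(1) x(1)] h(3) k by simp
  moreover have "e [^] n \<otimes> h \<noteq> \<zero>" using k h(1) hc by (simp add: integral_iff)
  ultimately show ?thesis using n by (intro algebraic_listI[of "e [^] n \<otimes> h" "map ((\<otimes>) (e [^] n)) ts"]) auto
qed

text \<open>A polynomial in \<open>t\<close> over E[z] is regrouped as a polynomial in
  \<open>z\<close> over E[t]. Each coefficient is given by a list \<open>r\<close> as long as
  \<open>p\<close>, so that prepending an entry to \<open>r\<close> contributes the correct power of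
  \<open>t\<close>. The last clause provides a coefficient polynomial that is visibly
  nonzero.\<close>

lemma exchange_aux:
  assumes E: "subring E R" and c: "t \<in> carrier R" "z \<in> carrier R" and p: "set p \<subseteq> simple_extension E z"
  shows "\<exists>Q. set Q \<subseteq> carrier R \<and> eval Q z = eval p t \<and>
    (\<forall>i. \<exists>r. set r \<subseteq> E \<and> length r = length p \<and> coeff Q i = eval r t) \<and>
    (p \<noteq> [] \<longrightarrow> hd p \<noteq> \<zero> \<longrightarrow> (\<exists>i r. set r \<subseteq> E \<and> r \<noteq> [] \<and> hd r \<noteq> \<zero> \<and> coeff Q i = eval r t))"
  using p
proof (induction p)
  case Nil
  then show ?case by (intro exI[of _ "[]"]) auto
next
  case (Cons h p)
  note EE = subringE[OF E]
  obtain Q where Q: "set Q \<subseteq> carrier R" "eval Q z = eval p t"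
    "\<And>i. \<exists>r. set r \<subseteq> E \<and> length r = length p \<and> coeff Q i = eval r t" using Cons by auto
  have "h \<in> simple_extension E z" using Cons.prems by simp
  then obtain q where q: "q \<in> carrier (E [X])" "set q \<subseteq> E" "h = eval q z" using simple_extension_evalE[OF E c(2)] by blast
  have qc: "set q \<subseteq> carrier R" using q EE by auto
  define T where "T = t [^] length p"
  have T: "T \<in> carrier R" using c by (simp add: T_def)
  have mc: "set (map ((\<otimes>) T) q) \<subseteq> carrier R" using qc T by auto
  define P where "P = poly_add (map ((\<otimes>) T) q) Q"
  have P1: "set P \<subseteq> carrier R" unfolding P_def by (rule poly_add_in_carrier[OF mc Q(1)])
  have P2: "eval P z = eval (h # p) t"
    unfolding P_def using eval_poly_add[OF mc Q(1) c(2)] eval_scale[OF qc T c(2)] Q(2) q(3) eval_in_carrier[OF qc c(2)] T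
    by (simp add: T_def m_comm del: poly_add.simps)
  have P3: "coeff P i = eval (coeff q i # r) t" if "length r = length p" "coeff Q i = eval r t" for i r
    unfolding P_def using poly_add_coeff[OF mc Q(1)] scalar_coeff[OF T, of q] that coeff_in_carrier[OF qc, of i] T
    by (simp add: T_def m_comm del: poly_add.simps)
  have cq: "coeff q i \<in> E" for i using coeff_img_restrict[of q] coeff_length[of q i] q(2) EE(2) by (cases "i < length q") auto
  have P4: "\<exists>r. set r \<subseteq> E \<and> length r = length (h # p) \<and> coeff P i = eval r t" for i
  proof -
    obtain r where "set r \<subseteq> E" "length r = length p" "coeff Q i = eval r t" using Q(3) by blast
    then show ?thesis using P3 cq by (intro exI[of _ "coeff q i # r"]) auto
  qed
  have P5: "\<exists>i r. set r \<subseteq> E \<and> r \<noteq> [] \<and> hd r \<noteq> \<zero> \<and> coeff P i = eval r t" if "h \<noteq> \<zero>"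
  proof -
    have "q \<noteq> []" using q that by auto
    then have "coeff q (length q - 1) \<noteq> \<zero>" using q(1) lead_coeff_simp[of q] by (simp add: univ_poly_def polynomial_def del: lead_coeff_simp)
    moreover obtain r where "set r \<subseteq> E" "length r = length p" "coeff Q (length q - 1) = eval r t" using Q(3) by blast
    ultimately show ?thesis using P3 cq by (intro exI[of _ "length q - 1"] exI[of _ "coeff q (length q - 1) # r"]) auto
  qed
  show ?case using P1 P2 P4 P5 by auto
qed

text \<open>Steinitz exchange. The regrouped polynomial is nonzero because one of its coefficients
  is a nonzero polynomial in \<open>t\<close>, whose value cannot vanish for transcendental
  \<open>t\<close>.\<close>

lemma algebraic_exchange:
  assumes E: "subring E R" and c: "t \<in> carrier R" "z \<in> carrier R"
    and t: "(transcendental over E) t" "(algebraic over (simple_extension E z)) t"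
  shows "(algebraic over (simple_extension E t)) z"
proof -
  obtain h ts where h: "h \<noteq> \<zero>" "set (h # ts) \<subseteq> simple_extension E z" "eval (h # ts) t = \<zero>"
    using algebraic_listE[OF simple_extension_is_subring[OF E c(2)] c(1) t(2)] .
  obtain Q where Q: "set Q \<subseteq> carrier R" "eval Q z = \<zero>"
      "\<And>i. \<exists>r. set r \<subseteq> E \<and> length r = length (h # ts) \<and> coeff Q i = eval r t"
      "\<exists>i r. set r \<subseteq> E \<and> r \<noteq> [] \<and> hd r \<noteq> \<zero> \<and> coeff Q i = eval r t"
    using exchange_aux[OF E c h(2)] h(1,3) by auto
  have ev: "eval r t \<in> simple_extension E t" if "set r \<subseteq> E" for r
  proof -
    have "normalize r \<in> carrier (E [X])" using normalize_gives_polynomial[OF that] univ_poly_carrier by blast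
    moreover have "eval (normalize r) t = eval r t" using eval_normalize[of r t] that subringE(1)[OF E] c(1) by auto
    ultimately show ?thesis unfolding simple_extension_as_eval_img[OF subringE(1)[OF E] c(1)] by (metis imageI)
  qed
  have "set Q \<subseteq> simple_extension E t"
  proof
    fix x assume "x \<in> set Q"
    then obtain i where "x = coeff Q i" using coeff_img_restrict[of Q] by auto
    then show "x \<in> simple_extension E t" using Q(3)[of i] ev by auto
  qed
  then have 1: "normalize Q \<in> carrier ((simple_extension E t) [X])" using normalize_gives_polynomial univ_poly_carrier by blast
  obtain i r where r: "set r \<subseteq> E" "r \<noteq> []" "hd r \<noteq> \<zero>" "coeff Q i = eval r t" using Q(4) by blast
  have "r \<in> carrier (E [X])" using r by (auto simp: univ_poly_def polynomial_def)
  then have "eval r t \<noteq> \<zero>" using eval_transcendental[OF t(1)] r by blast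
  then have "normalize Q \<noteq> []" using normalize_coeff[of Q] r(4) by (auto dest: fun_cong[of _ _ i])
  then show ?thesis using algebraicI[OF 1] eval_normalize[OF Q(1) c(2)] Q(2) by simp
qed

text \<open>In place of a transcendence basis containing \<open>t\<close>, take \<open>E\<close>
  maximal among the subrings between \<open>E0\<close> and \<open>F\<close> over which
  \<open>t\<close> is transcendental. Adjoining inverses preserves this property, so
  \<open>E\<close> is a field; and any \<open>z\<close> in \<open>F\<close> outside \<open>E\<close>
  makes \<open>t\<close> algebraic over E[z], so that exchange applies.\<close>

lemma exists_maximal_transcendental_subfield:
  assumes E0: "subring E0 R" and F: "subfield F R" "E0 \<subseteq> F" and t: "t \<in> F" "(transcendental over E0) t"
  shows "\<exists>E. subfield E R \<and> E0 \<subseteq> E \<and> E \<subseteq> F \<and> (transcendental over E) t \<and>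
    (\<forall>z\<in>F. (algebraic over (simple_extension E t)) z)"
proof -
  note FS = subfieldE(1)[OF F(1)]
  note FE = subringE[OF FS]
  have tc: "t \<in> carrier R" using t FE by auto
  let ?S = "{E. subring E R \<and> E0 \<subseteq> E \<and> E \<subseteq> F \<and> (transcendental over E) t}"
  have "\<exists>M\<in>?S. \<forall>N\<in>?S. M \<subseteq> N \<longrightarrow> N = M"
  proof (rule subset_Zorn_nonempty)
    show "?S \<noteq> {}" using E0 F t by auto
    fix C assume C: "C \<noteq> {}" "subset.chain ?S C"
    then have "subset.chain {V. subring V R} C" by (auto simp: subset.chain_def)
    then have CS: "subring (\<Union>C) R" using subring_Union_chain C by blast
    have "(transcendental over (\<Union>C)) t"
    proof (rule ccontr)
      assume "\<not> ?thesis"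
      then obtain h ts where h: "h \<noteq> \<zero>" "set (h # ts) \<subseteq> \<Union>C" "eval (h # ts) t = \<zero>"
        using algebraic_listE[OF CS tc] by (auto simp: over_def)
      obtain E where E: "E \<in> C" "set (h # ts) \<subseteq> E" using finite_subset_Union_chain[OF _ h(2) C] by auto
      then have "(algebraic over E) t" using algebraic_listI[OF h(1) _ h(3)] by blast
      then show False using E C by (auto simp: subset.chain_def over_def)
    qed
    then show "\<Union>C \<in> ?S" using CS C by (auto simp: subset.chain_def)
  qed
  then obtain E where ES: "E \<in> ?S" and EM: "\<forall>N\<in>?S. E \<subseteq> N \<longrightarrow> N = E" by (elim bexE)
  then have E: "subring E R" "E0 \<subseteq> E" "E \<subseteq> F" "(transcendental over E) t" by auto
  have max: "x \<in> E" if "x \<in> F" "(transcendental over (simple_extension E x)) t" for x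
  proof -
    have xc: "x \<in> carrier R" using that FE by auto
    have "simple_extension E x \<in> ?S"
      using simple_extension_is_subring[OF E(1) xc] simple_extension_incl[OF subringE(1)[OF E(1)] xc] E that
        simple_extension_subring_incl[OF FS E(3) that(1)] by auto
    then have "simple_extension E x = E" using EM simple_extension_incl[OF subringE(1)[OF E(1)] xc] by blast
    then show ?thesis using simple_extension_mem[OF E(1) xc] by simp
  qed
  have "subfield E R"
  proof (rule subfieldI'[OF E(1)])
    fix k assume k: "k \<in> E - {\<zero>}"
    then have "(transcendental over (simple_extension E (inv k))) t"
      using algebraic_over_simple_extension_inv[OF E(1) _ _ tc, of k] E(4) by (auto simp: over_def)
    moreover have "inv k \<in> F" using subfield_m_inv(1)[OF F(1), of k] k E by auto
    ultimately show "inv k \<in> E" using max by blast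
  qed
  moreover have "(algebraic over (simple_extension E t)) z" if z: "z \<in> F" for z
  proof (cases "(transcendental over (simple_extension E z)) t")
    case True
    then have "(algebraic over E) z" using max[OF z] algebraic_self[OF E(1)] by blast
    then show ?thesis using algebraic_mono[OF simple_extension_incl[OF subringE(1)[OF E(1)] tc]] by blast
  next
    case False
    then show ?thesis using algebraic_exchange[OF E(1) tc _ E(4)] z FE by (auto simp: over_def)
  qed
  ultimately show ?thesis using E by blast
qed

end

section \<open>Fields algebraic over the prime field\<close>

lemma dvd_poly_diff: "x - y dvd poly p x - poly p y" for p :: "'a::comm_ring_1 poly"
proof (induction p)
  case (pCons a p)
  have "poly (pCons a p) x - poly (pCons a p) y = (x - y) * poly p x + y * (poly p x - poly p y)"
    by (simp add: algebra_simps)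
  then show ?case using pCons.IH by simp
qed simp

text \<open>Modulo e n the values at m0 + e n y equal e = G(m0), so they have the form e (1 + n j)
  with 1 + n j coprime to n. Such a value divides a power of n only if 1 + n j is 1 or -1, and
  \<open>y\<close> is chosen to avoid this.\<close>

lemma exists_poly_value_not_dvd_power:
  fixes G :: "int poly" and n :: int
  assumes G: "Polynomial.degree G > 0" and n: "n \<noteq> 0"
  shows "\<exists>m. poly G m \<noteq> 0 \<and> (\<forall>k. \<not> poly G m dvd n ^ k)"
proof -
  have fin: "finite {x. poly G x = c}" for c
  proof -
    have "G - [:c:] \<noteq> 0" using G by (metis degree_pCons_0 eq_iff_diff_eq_0 less_irrefl)
    then show ?thesis using poly_roots_finite[of "G - [:c:]"] by simp
  qed
  obtain m0 where e: "poly G m0 \<noteq> 0" using fin[of 0] by (metis (mono_tags) finite_subset infinite_UNIV_int mem_Collect_eq subsetI)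
  define e where "e = poly G m0"
  have e0: "e \<noteq> 0" using e by (simp add: e_def)
  have "finite ({x. poly G x = 0} \<union> {x. poly G x = e} \<union> {x. poly G x = - e})" using fin by blast
  moreover have "inj (\<lambda>y. m0 + e * n * y)" using e0 n by (auto simp: inj_def)
  ultimately have "finite ((\<lambda>y. m0 + e * n * y) -` ({x. poly G x = 0} \<union> {x. poly G x = e} \<union> {x. poly G x = - e}))"
    by (intro finite_vimageI)
  then obtain y where "y \<notin> (\<lambda>y. m0 + e * n * y) -` ({x. poly G x = 0} \<union> {x. poly G x = e} \<union> {x. poly G x = - e})"
    by (metis ex_new_if_finite infinite_UNIV_int)
  then have y: "poly G (m0 + e * n * y) \<noteq> 0" "poly G (m0 + e * n * y) \<noteq> e" "poly G (m0 + e * n * y) \<noteq> - e" by auto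
  have "e * n dvd poly G (m0 + e * n * y) - e"
    using dvd_poly_diff[of "m0 + e * n * y" m0 G] unfolding e_def by (auto dest: dvd_mult_left)
  then obtain j where "poly G (m0 + e * n * y) - e = e * n * j" by blast
  then have j: "poly G (m0 + e * n * y) = e * (1 + n * j)" by (simp add: algebra_simps)
  have "\<not> poly G (m0 + e * n * y) dvd n ^ k" for k
  proof
    assume "poly G (m0 + e * n * y) dvd n ^ k"
    then have "(1 + n * j) dvd n ^ k" unfolding j using dvd_mult_right by blast
    moreover have "coprime (1 + n * j) n"
    proof (rule coprimeI)
      fix d assume d: "d dvd 1 + n * j" "d dvd n"
      have "d dvd (1 + n * j) - n * j" using d by (intro dvd_diff dvd_mult2)
      then show "is_unit d" by simp
    qed
    then have "coprime (1 + n * j) (n ^ k)" by simp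
    ultimately have "is_unit (1 + n * j)" by (metis coprime_common_divisor dvd_refl)
    then have "\<bar>1 + n * j\<bar> = 1" by simp
    then have "1 + n * j = 1 \<or> 1 + n * j = -1" by linarith
    then have "e * (1 + n * j) = e \<or> e * (1 + n * j) = - e"
      by (elim disjE) (simp_all only: mult_1_right mult_minus_right simp_thms)
    then show False using y(2,3) j by simp
  qed
  then show ?thesis using y by blast
qed

context field
begin

text \<open>The image of the integers rather than its field of fractions: which integers become
  invertible in a valuation ring is what has to be controlled.\<close>

definition prime_ring :: "'a set" where "prime_ring = range (\<lambda>n. \<guillemotleft>n\<guillemotright>)"

lemma prime_ring_subring: "subring prime_ring R"
proof (rule subringI)
  have mem: "\<guillemotleft>n\<guillemotright> \<in> prime_ring" for n by (simp add: prime_ring_def)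
  show "\<one> \<in> prime_ring" using mem[of 1] by simp
  show "\<ominus> x \<in> prime_ring" if x: "x \<in> prime_ring" for x
  proof -
    obtain i where "x = \<guillemotleft>i\<guillemotright>" using x by (auto simp: prime_ring_def)
    then show ?thesis using mem[of "- i"] by simp
  qed
  fix x y assume "x \<in> prime_ring" "y \<in> prime_ring"
  then obtain i j where "x = \<guillemotleft>i\<guillemotright>" "y = \<guillemotleft>j\<guillemotright>" by (auto simp: prime_ring_def)
  then show "x \<otimes> y \<in> prime_ring" "x \<oplus> y \<in> prime_ring" using mem[of "i * j"] mem[of "i + j"] by simp_all
qed (auto simp: prime_ring_def)

lemma prime_ring_le: "subring V R \<Longrightarrow> prime_ring \<subseteq> V"
proof -
  assume V: "subring V R"
  have "\<guillemotleft>n\<guillemotright>\<^sub>\<nat> \<in> V" for n by (induction n) (use subringE[OF V] in auto)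
  then show ?thesis using subringE(5)[OF V] by (auto simp: prime_ring_def of_integer_def)
qed

text \<open>With t = 1 the results on integral hulls over E[t] become statements about the prime
  ring with one of its elements inverted.\<close>

lemma prime_ring_simple_extension_one: "simple_extension prime_ring \<one> = prime_ring"
  using simple_extension_subring_incl[OF prime_ring_subring, of prime_ring \<one>] subringE(3)[OF prime_ring_subring]
    simple_extension_incl[OF subringE(1)[OF prime_ring_subring], of \<one>] by auto

text \<open>Connects the type \<open>int poly\<close>, for which contents and pseudo-division are at
  hand, with elements of the field.\<close>

definition int_eval :: "int poly \<Rightarrow> 'a \<Rightarrow> 'a" where
  "int_eval p a = fold_coeffs (\<lambda>c r. \<guillemotleft>c\<guillemotright> \<oplus> a \<otimes> r) p \<zero>"

lemma int_eval_0 [simp]: "int_eval 0 a = \<zero>"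
  by (simp add: int_eval_def)

lemma int_eval_pCons [simp]: "a \<in> carrier R \<Longrightarrow> int_eval (pCons c p) a = \<guillemotleft>c\<guillemotright> \<oplus> a \<otimes> int_eval p a"
  by (cases "c = 0 \<and> p = 0") (auto simp: int_eval_def)

lemma int_eval_closed [simp]: "a \<in> carrier R \<Longrightarrow> int_eval p a \<in> carrier R"
  by (induction p) auto

lemma int_eval_add [simp]:
  assumes "a \<in> carrier R" shows "int_eval (p + q) a = int_eval p a \<oplus> int_eval q a"
proof (induction p q rule: poly_induct2)
  case (pCons c p d q)
  then show ?case using assms by (simp add: r_distr a_ac)
qed simp

lemma int_eval_smult [simp]:
  assumes "a \<in> carrier R" shows "int_eval (smult c p) a = \<guillemotleft>c\<guillemotright> \<otimes> int_eval p a"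
proof (induction p)
  case (pCons d p)
  then show ?case using assms by (simp add: r_distr m_ac)
qed simp

lemma int_eval_mult [simp]:
  assumes "a \<in> carrier R" shows "int_eval (p * q) a = int_eval p a \<otimes> int_eval q a"
proof (induction p)
  case (pCons c p)
  then show ?case using assms by (simp add: l_distr r_distr m_ac)
qed (use assms in simp)

lemma int_eval_diff [simp]:
  assumes "a \<in> carrier R" shows "int_eval (p - q) a = int_eval p a \<ominus> int_eval q a"
proof -
  have "int_eval (p - q) a \<oplus> int_eval q a = int_eval p a" using int_eval_add[OF assms, of "p - q" q] by simp
  then show ?thesis using assms by (metis add.inv_solve_right int_eval_closed minus_eq)
qed

lemma int_eval_pcompose:
  assumes "a \<in> carrier R" shows "int_eval (pcompose p [:- m, 1:]) a = int_eval p (a \<ominus> \<guillemotleft>m\<guillemotright>)"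
proof (induction p)
  case (pCons c p)
  have "int_eval [:- m, 1:] a = a \<ominus> \<guillemotleft>m\<guillemotright>" using assms by (simp add: minus_eq a_comm)
  moreover have "int_eval (pcompose (pCons c p) [:- m, 1:]) a
      = int_eval [:c:] a \<oplus> int_eval [:- m, 1:] a \<otimes> int_eval (pcompose p [:- m, 1:]) a"
    by (simp only: pcompose_pCons int_eval_add[OF assms] int_eval_mult[OF assms])
  ultimately show ?case using assms pCons by simp
qed simp

lemma prime_ring_list:
  assumes "a \<in> carrier R" "set p \<subseteq> prime_ring"
  obtains ns where "p = map (\<lambda>n. \<guillemotleft>n\<guillemotright>) ns" "eval p a = int_eval (Poly (rev ns)) a"
proof -
  obtain ns where ns: "p = map (\<lambda>n. \<guillemotleft>n\<guillemotright>) ns" using assms(2) unfolding prime_ring_def by (metis ex_map_conv image_iff subsetD)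
  have "eval (map (\<lambda>n. \<guillemotleft>n\<guillemotright>) ns) a = int_eval (Poly (rev ns)) a" for ns
  proof (induction ns rule: rev_induct)
    case (snoc n ns)
    have "eval (map (\<lambda>n. \<guillemotleft>n\<guillemotright>) ns @ [\<guillemotleft>n\<guillemotright>]) a = eval (map (\<lambda>n. \<guillemotleft>n\<guillemotright>) ns) a \<otimes> a \<oplus> \<guillemotleft>n\<guillemotright>"
      using assms by (intro eval_append_aux) auto
    then show ?case using snoc assms by (simp add: m_comm a_comm)
  qed simp
  then show ?thesis using that ns by blast
qed

text \<open>Gauss's lemma: \<open>G\<close> is the primitive part of a polynomial of least degree
  vanishing at \<open>a\<close>, and so divides the others over the integers and not merely over the
  rationals.\<close>

lemma exists_generating_int_poly:
  assumes ch: "\<And>n. \<guillemotleft>n\<guillemotright> = \<zero> \<Longrightarrow> n = 0" and a: "a \<in> carrier R" "(algebraic over prime_ring) a"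
  obtains G where "Polynomial.degree G > 0" "\<And>q. int_eval q a = \<zero> \<Longrightarrow> G dvd q"
proof -
  obtain h ts where h: "h \<noteq> \<zero>" "set (h # ts) \<subseteq> prime_ring" "eval (h # ts) a = \<zero>"
    using algebraic_listE[OF prime_ring_subring a] .
  obtain ns where ns: "h # ts = map (\<lambda>n. \<guillemotleft>n\<guillemotright>) ns" "\<zero> = int_eval (Poly (rev ns)) a"
    using prime_ring_list[OF a(1) h(2)] h(3) by metis
  have "Poly (rev ns) \<noteq> 0"
  proof
    assume "Poly (rev ns) = 0"
    then have "\<forall>n\<in>set ns. n = 0" by (metis Poly_eq_0 in_set_replicate set_rev)
    then have "hd ns = 0" using ns(1) by (cases ns) auto
    then show False using ns(1) h(1) by (cases ns) auto
  qed
  then have "\<exists>p. p \<noteq> 0 \<and> int_eval p a = \<zero>" using ns(2) by metis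
  then obtain H where H: "H \<noteq> 0" "int_eval H a = \<zero>"
    and min: "\<And>p. p \<noteq> 0 \<Longrightarrow> int_eval p a = \<zero> \<Longrightarrow> Polynomial.degree H \<le> Polynomial.degree p"
    using ex_has_least_nat[of "\<lambda>p. p \<noteq> 0 \<and> int_eval p a = \<zero>" _ Polynomial.degree] by metis
  define G where "G = primitive_part H"
  have HG: "H = smult (content H) G" by (simp add: G_def)
  have cH: "content H \<noteq> 0" using H by simp
  have cG: "content G = 1" using H by (simp add: G_def)
  have G0: "G \<noteq> 0" using cG by auto
  have "\<guillemotleft>content H\<guillemotright> \<otimes> int_eval G a = \<zero>" using H(2) a(1) by (subst (asm) HG) simp
  moreover have "\<guillemotleft>content H\<guillemotright> \<noteq> \<zero>" using ch cH by blast
  ultimately have evG: "int_eval G a = \<zero>" using a(1) by (simp add: integral_iff)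
  have degG: "Polynomial.degree G = Polynomial.degree H" using cH by (subst HG) simp
  have "Polynomial.degree G \<noteq> 0"
  proof
    assume "Polynomial.degree G = 0"
    then obtain g where "G = [:g:]" by (metis degree_eq_zeroE)
    then show False using evG G0 a(1) ch by auto
  qed
  moreover have "G dvd q" if q: "int_eval q a = \<zero>" for q
  proof -
    obtain c s where cs: "c \<noteq> 0" "smult c q = G * s + pseudo_mod q G" using pseudo_mod(1)[OF G0] by blast
    have "int_eval (pseudo_mod q G) a = int_eval (smult c q - G * s) a" by (simp add: cs(2))
    also have "\<dots> = \<zero>" using q evG a(1) by simp
    finally have "pseudo_mod q G = 0" using min pseudo_mod(2)[OF G0, of q] degG by force
    then have eq: "smult c q = G * s" using cs by simp
    \<comment> \<open>Contents are multiplicative and \<open>G\<close> is primitive, so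
      \<open>c\<close> divides all coefficients of \<open>s\<close> and can be cancelled.\<close>
    then have "normalization_semidom_class.normalize c * content q = content s" using cG by (metis content_mult content_smult mult_1)
    then have "[:c:] dvd s" unfolding const_poly_dvd_iff_dvd_content by (metis dvd_triv_left normalize_dvd_iff)
    then obtain s' where "s = [:c:] * s'" by blast
    then have "s = smult c s'" by simp
    then have "smult c q = smult c (G * s')" using eq by simp
    then have "q = G * s'" using cs(1) smult_cancel[of c q "G * s'"] by simp
    then show ?thesis by simp
  qed
  ultimately show ?thesis using that by blast
qed

text \<open>Otherwise the inverse of a - m is integral over the prime ring with \<open>inv N\<close>
  adjoined. Clearing denominators gives an integer polynomial (X - m) Q - n^k that vanishes at
  \<open>a\<close> and is hence a multiple of \<open>G\<close>; at X = m it shows that G(m) divides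
  n^k, which the choice of \<open>m\<close> forbids.\<close>

lemma separating_valuation_ring_int:
  assumes ch: "\<And>n. \<guillemotleft>n\<guillemotright> = \<zero> \<Longrightarrow> n = 0" and a: "a \<in> carrier R" "(algebraic over prime_ring) a"
    and N: "N \<in> prime_ring" "N \<noteq> \<zero>"
  shows "\<exists>m::int. \<exists>V. valuation_ring V \<and> inv N \<in> V \<and> a \<noteq> \<guillemotleft>m\<guillemotright> \<and> inv (a \<ominus> \<guillemotleft>m\<guillemotright>) \<notin> V"
proof -
  obtain G where G: "Polynomial.degree G > 0" "\<And>q. int_eval q a = \<zero> \<Longrightarrow> G dvd q"
    using exists_generating_int_poly[OF ch a] by blast
  obtain n where "N = \<guillemotleft>n\<guillemotright>" using N(1) by (auto simp: prime_ring_def)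
  with N(2) have n: "N = \<guillemotleft>n\<guillemotright>" "n \<noteq> 0" by auto
  obtain m where m: "poly G m \<noteq> 0" "\<And>k. \<not> poly G m dvd n ^ k" using exists_poly_value_not_dvd_power[OF G(1) n(2)] by blast
  have lin: "int_eval [:- m, 1:] a = a \<ominus> \<guillemotleft>m\<guillemotright>" using a(1) by (simp add: minus_eq a_comm)
  \<comment> \<open>For a = m the polynomial X - m would be a constant multiple of \<open>G\<close>,
    and \<open>m\<close> a root of \<open>G\<close>.\<close>
  have am: "a \<noteq> \<guillemotleft>m\<guillemotright>"
  proof
    assume "a = \<guillemotleft>m\<guillemotright>"
    then have "G dvd [:- m, 1:]" using G(2) lin a(1) by simp
    moreover have "Polynomial.degree [:- m, 1:] = 1" by simp
    ultimately obtain s where s: "[:- m, 1:] = G * s" by blast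
    then have "G \<noteq> 0" "s \<noteq> 0" by auto
    then have "Polynomial.degree (G * s) = Polynomial.degree G + Polynomial.degree s" by (rule degree_mult_eq)
    moreover have "Polynomial.degree (G * s) = 1" by (simp flip: s)
    moreover note \<open>s \<noteq> 0\<close>
    ultimately have "Polynomial.degree s = 0" using G(1) by simp
    then obtain d where "s = [:d:]" by (metis degree_eq_zeroE)
    then have "poly G m * d = 0" using arg_cong[OF s, of "\<lambda>p. poly p m"] by auto
    then show False using m(1) \<open>s \<noteq> 0\<close> \<open>s = [:d:]\<close> by auto
  qed
  define y where "y = a \<ominus> \<guillemotleft>m\<guillemotright>"
  have y: "y \<in> carrier R" "y \<noteq> \<zero>" using a am by (auto simp: y_def)
  have iN: "inv N \<in> carrier R" using N subringE(1)[OF prime_ring_subring] by auto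
  let ?B = "simple_extension prime_ring (inv N)"
  note P = prime_ring_subring subringE[OF prime_ring_subring]
  have B: "subring ?B R" "inv N \<in> ?B"
    using simple_extension_is_subring[OF P(1) iN] simple_extension_mem[OF P(1) iN] by auto
  have "\<exists>V. valuation_ring V \<and> ?B \<subseteq> V \<and> inv y \<notin> V"
  proof (rule ccontr)
    assume "\<not> ?thesis"
    then have "inv y \<in> simple_extension ?B (inv (inv y))"
      using y nonzero_imp_inverse_nonzero by (intro mem_simple_extension_inv[OF B(1)]) auto
    then have "inv y \<in> simple_extension ?B y" using y by (simp add: nonzero_inverse_inverse_eq)
    then obtain p where p: "set p \<subseteq> ?B" "inv y = eval p y" using simple_extension_evalE[OF B(1) y(1)] by metis
    obtain k :: nat where k: "\<forall>c\<in>set p. N [^] k \<otimes> c \<in> prime_ring"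
      using simple_extension_inv_common_denom[OF P(1) N p(1)] by blast
    have Nk: "N [^] k \<in> carrier R" using N P(2) by auto
    have "set p \<subseteq> carrier R" using p(1) subringE(1)[OF B(1)] by auto
    then have "N [^] k \<otimes> inv y = eval (map ((\<otimes>) (N [^] k)) p) y" using eval_scale[OF _ Nk y(1)] p(2) by simp
    also obtain ns where "\<dots> = int_eval (Poly (rev ns)) y"
      using prime_ring_list[OF y(1), of "map ((\<otimes>) (N [^] k)) p"] k by (metis (no_types, lifting) ex_map_conv image_subset_iff list.set_map)
    also have "\<dots> = int_eval (pcompose (Poly (rev ns)) [:- m, 1:]) a" using int_eval_pcompose[OF a(1)] by (simp add: y_def)
    finally obtain Q where Q: "N [^] k \<otimes> inv y = int_eval Q a" by blast
    have "int_eval ([:- m, 1:] * Q) a = y \<otimes> (N [^] k \<otimes> inv y)"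
      unfolding Q int_eval_mult[OF a(1)] lin by (simp add: y_def)
    also have "\<dots> = N [^] k" using m_lcomm[OF y(1) Nk inv_closed[OF y]] y Nk by simp
    also have "\<dots> = \<guillemotleft>n ^ k\<guillemotright>" using n by simp
    finally have "int_eval ([:- m, 1:] * Q - [:n ^ k:]) a = \<zero>" using a(1) by (simp del: mult_pCons_left int_eval_mult)
    then obtain s where s: "[:- m, 1:] * Q - [:n ^ k:] = G * s" using G(2) by blast
    have "poly G m * poly s m = - (n ^ k)" using arg_cong[OF s, of "\<lambda>p. poly p m"] by simp
    then have "poly G m dvd n ^ k" by (metis dvd_minus_iff dvd_triv_left)
    then show False using m(2) by blast
  qed
  then show ?thesis using am B(2) unfolding y_def by blast
qed

text \<open>The inverse \<open>z\<close> of \<open>x\<close> lies in all valuation rings above the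
  prime ring with a suitable \<open>inv N\<close> adjoined. So \<open>z\<close> is integral over
  that ring in the form that makes \<open>inv z\<close>, that is \<open>x\<close>, algebraic over
  it; finally the denominators are cleared.\<close>

lemma algebraic_over_prime_ring_trans:
  assumes F: "subfield F R" "\<And>z. z \<in> F \<Longrightarrow> (algebraic over prime_ring) z" and x: "x \<in> carrier R" "(algebraic over F) x"
  shows "(algebraic over prime_ring) x"
proof (cases "x = \<zero>")
  case True
  then show ?thesis using zero_is_algebraic[OF prime_ring_subring] by simp
next
  case False
  define z where "z = inv x"
  have z: "z \<in> carrier R" "z \<noteq> \<zero>" "inv z = x" "(algebraic over F) z"
    using x False nonzero_imp_inverse_nonzero nonzero_inverse_inverse_eq algebraic_inv[OF F(1)] by (auto simp: z_def)
  note P = prime_ring_subring subringE[OF prime_ring_subring]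
  obtain N where N: "N \<in> prime_ring - {\<zero>}" "z \<in> integral_hull prime_ring {\<one>, inv N}"
    using algebraic_trans_imp_integral_hull[OF P(1) one_closed F(1), of "{z}"] F(2) z
    unfolding prime_ring_simple_extension_one by auto
  have iN: "inv N \<in> carrier R" using N P(2) by auto
  let ?B = "simple_extension prime_ring (inv N)"
  have B: "subring ?B R" "inv N \<in> ?B"
    using simple_extension_is_subring[OF P(1) iN] simple_extension_mem[OF P(1) iN] by auto
  have "z \<in> V" if V: "valuation_ring V" "?B \<subseteq> V" for V
  proof -
    note VE = subringE[OF valuation_ring_subring[OF V(1)]]
    have "scales prime_ring {\<one>, inv N} V \<one>"
      using V B VE prime_ring_le[OF valuation_ring_subring[OF V(1)]] iN by (auto simp: scales_def)
    then have "\<exists>s::nat. \<one> [^] s \<otimes> z \<in> V" using N(2) unfolding integral_hull_def by blast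
    then show ?thesis using z(1) by auto
  qed
  then have "z \<in> simple_extension ?B (inv z)" using mem_simple_extension_inv[OF B(1) z(1,2)] by blast
  then have "(algebraic over ?B) (inv z)" by (rule algebraic_if_mem_simple_extension_inv[OF B(1) z(1,2)])
  then show ?thesis using algebraic_over_simple_extension_inv[OF P(1), of N] N x unfolding z(3) by auto
qed

text \<open>With a common denominator \<open>N\<close> for the elements of \<open>Z\<close> and
  their inverses, any valuation ring containing \<open>inv N\<close> contains them all; the integer
  \<open>m\<close> is then found relative to this \<open>N\<close>.\<close>

lemma separating_valuation_ring_prime_ring:
  assumes ch: "\<And>n. \<guillemotleft>n\<guillemotright> = \<zero> \<Longrightarrow> n = 0"
    and F: "subfield F R" "\<And>z. z \<in> F \<Longrightarrow> (algebraic over prime_ring) z"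
    and a: "a \<in> carrier R" "(algebraic over F) a"
    and Z: "finite Z" "Z \<subseteq> carrier R - {\<zero>}" "\<And>z. z \<in> Z \<Longrightarrow> (algebraic over F) z"
  shows "\<exists>c\<in>F. \<exists>V. valuation_ring V \<and> a \<noteq> c \<and> inv (a \<ominus> c) \<notin> V \<and> (\<forall>z\<in>Z. z \<in> V \<and> inv z \<in> V)"
proof -
  let ?Y = "Z \<union> m_inv R ` Z"
  have "(algebraic over F) x" if "x \<in> ?Y" for x
    using that Z algebraic_inv[OF F(1)] by auto
  moreover have Y: "finite ?Y" "?Y \<subseteq> carrier R" using Z inv_closed by blast+
  ultimately obtain N where N: "N \<in> prime_ring - {\<zero>}" "?Y \<subseteq> integral_hull prime_ring {\<one>, inv N}"
    using algebraic_trans_imp_integral_hull[OF prime_ring_subring one_closed F(1)] F(2)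
    unfolding prime_ring_simple_extension_one by meson
  obtain m :: int and V where V: "valuation_ring V" "inv N \<in> V" "a \<noteq> \<guillemotleft>m\<guillemotright>" "inv (a \<ominus> \<guillemotleft>m\<guillemotright>) \<notin> V"
    using separating_valuation_ring_int[OF ch a(1) algebraic_over_prime_ring_trans[OF F a], of N] N(1) by blast
  note VE = subringE[OF valuation_ring_subring[OF V(1)]]
  have sc: "scales prime_ring {\<one>, inv N} V \<one>"
    using V(2) VE prime_ring_le[OF valuation_ring_subring[OF V(1)]] V(1) by (auto simp: scales_def)
  have "x \<in> V" if "x \<in> ?Y" for x
  proof -
    have "x \<in> integral_hull prime_ring {\<one>, inv N}" using N(2) that by blast
    then have "\<exists>s::nat. \<one> [^] s \<otimes> x \<in> V" using sc unfolding integral_hull_def by blast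
    then show ?thesis using Y that by auto
  qed
  moreover have "\<guillemotleft>m\<guillemotright> \<in> F" using prime_ring_le[OF subfieldE(1)[OF F(1)]] by (auto simp: prime_ring_def)
  ultimately show ?thesis using V by blast
qed

section \<open>Torsion in positive characteristic\<close>

lemma finite_subring_torsion:
  assumes "subring D R" "finite D" "e \<in> D" "e \<noteq> \<zero>"
  shows "\<exists>k>0. e [^] (k::nat) = \<one>"
proof -
  have e: "e \<in> carrier R" using assms subringE(1) by blast
  have "range (\<lambda>k::nat. e [^] k) \<subseteq> D" using nat_pow_in_subring[OF assms(1,3)] by auto
  then have "\<not> inj (\<lambda>k::nat. e [^] k)" using assms(2) finite_imageD finite_subset infinite_UNIV_nat by metis
  then obtain i j :: nat where ij: "e [^] i = e [^] j" "i < j" unfolding inj_def by (metis linorder_neqE_nat)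
  have ei: "e [^] i \<in> carrier R" "e [^] i \<noteq> \<zero>" using e assms by auto
  have "e [^] i \<otimes> e [^] (j - i) = e [^] (i + (j - i))" by (rule nat_pow_mult[OF e])
  also have "\<dots> = e [^] i" using ij by simp
  finally have "e [^] i \<otimes> e [^] (j - i) = e [^] i \<otimes> \<one>" using e by simp
  then have "e [^] (j - i) = \<one>" using m_lcancel[OF ei(2,1) nat_pow_closed[OF e] one_closed] by blast
  then show ?thesis using ij by (intro exI[of _ "j - i"]) auto
qed

text \<open>The prime ring is a finite field, adjoining an algebraic element keeps it finite, and
  nonzero elements of a finite subring of a field are roots of unity.\<close>

lemma algebraic_over_prime_ring_torsion:
  assumes n: "\<guillemotleft>n\<guillemotright> = \<zero>" "n \<noteq> 0" and x: "x \<in> carrier R" "x \<noteq> \<zero>" "(algebraic over prime_ring) x"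
  shows "\<exists>k>0. x [^] (k::nat) = \<one>"
proof -
  note P = prime_ring_subring subringE[OF prime_ring_subring]
  have "\<guillemotleft>i\<guillemotright> \<in> (\<lambda>i. \<guillemotleft>i\<guillemotright>) ` {-\<bar>n\<bar>..\<bar>n\<bar>}" for i
  proof -
    have "\<guillemotleft>i\<guillemotright> = \<guillemotleft>i div n * n + i mod n\<guillemotright>" by simp
    also have "\<dots> = \<guillemotleft>i mod n\<guillemotright>" unfolding of_int_add of_int_mult n(1) by simp
    finally have "\<guillemotleft>i\<guillemotright> = \<guillemotleft>i mod n\<guillemotright>" .
    moreover have "\<bar>i mod n\<bar> < \<bar>n\<bar>" using n(2) by (rule abs_mod_less)
    ultimately show ?thesis by (intro image_eqI[of _ _ "i mod n"]) auto
  qed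
  then have "prime_ring \<subseteq> (\<lambda>i. \<guillemotleft>i\<guillemotright>) ` {-\<bar>n\<bar>..\<bar>n\<bar>}" unfolding prime_ring_def by blast
  then have fin: "finite prime_ring" by (rule finite_subset) simp
  have K: "subfield prime_ring R"
  proof (rule subfieldI'[OF P(1)])
    fix e assume e: "e \<in> prime_ring - {\<zero>}"
    then obtain k :: nat where k: "k > 0" "e [^] k = \<one>" using finite_subring_torsion[OF P(1) fin] by auto
    have ec: "e \<in> carrier R" using e P by auto
    have "e [^] (k - 1) \<otimes> e = \<one>" using k by (metis Suc_diff_1 nat_pow_Suc)
    then have "inv e = e [^] (k - 1)" using ec by (simp add: comm_inv_char m_comm)
    then show "inv e \<in> prime_ring" using nat_pow_in_subring[OF P(1)] e by auto
  qed
  let ?d = "length (Irr prime_ring x) - 1"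
  have "simple_extension prime_ring x = (\<lambda>p. eval p x) ` {p \<in> carrier (prime_ring [X]). length p \<le> ?d}"
    using Span_exp_base[OF K x(1,3)] Span_eq_eval_img[OF K x(1)] by simp
  moreover have "{p \<in> carrier (prime_ring [X]). length p \<le> ?d} \<subseteq> {p. set p \<subseteq> prime_ring \<and> length p \<le> ?d}"
    by (auto simp: univ_poly_def polynomial_def)
  ultimately have "simple_extension prime_ring x \<subseteq> (\<lambda>p. eval p x) ` {p. set p \<subseteq> prime_ring \<and> length p \<le> ?d}" by blast
  then have "finite (simple_extension prime_ring x)"
    by (rule finite_subset) (rule finite_imageI[OF finite_lists_length_le[OF fin]])
  then show ?thesis
    using finite_subring_torsion[OF simple_extension_is_subring[OF P(1) x(1)]] simple_extension_mem[OF P(1) x(1)] x by blast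
qed

end

section \<open>The rational rank\<close>

lemma int_linear_dependence:
  fixes m :: "'i \<Rightarrow> 's \<Rightarrow> int"
  assumes "finite S" "finite I" "card S < card I"
  shows "\<exists>e. (\<exists>i\<in>I. e i \<noteq> 0) \<and> (\<forall>s\<in>S. (\<Sum>i\<in>I. e i * m i s) = 0)"
  using assms
proof (induction S arbitrary: I m rule: finite_induct)
  case empty
  then have "I \<noteq> {}" by auto
  then show ?case by (intro exI[of _ "\<lambda>_. 1"]) auto
next
  case (insert s S)
  show ?case
  proof (cases "\<forall>i\<in>I. m i s = 0")
    case True
    obtain e where "\<exists>i\<in>I. e i \<noteq> 0" "\<forall>s\<in>S. (\<Sum>i\<in>I. e i * m i s) = 0"
      using insert.IH[of I m] insert.prems insert.hyps by auto
    then show ?thesis using True by (intro exI[of _ e]) auto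
  next
    case False
    then obtain p where p: "p \<in> I" "m p s \<noteq> 0" by auto
    have "card S < card (I - {p})" using insert.prems insert.hyps p by simp
    then obtain e where e: "\<exists>i\<in>I - {p}. e i \<noteq> 0"
      "\<forall>s'\<in>S. (\<Sum>i\<in>I - {p}. e i * (m p s * m i s' - m i s * m p s')) = 0"
      using insert.IH[of "I - {p}" "\<lambda>i s'. m p s * m i s' - m i s * m p s'"] insert.prems by auto
    \<comment> \<open>The other coefficients are multiplied by the pivot \<open>m p s\<close>, so
      that the equation at \<open>s\<close> can be solved for the unknown at \<open>p\<close>
      without division.\<close>
    define e' where "e' i = (if i = p then - (\<Sum>i\<in>I - {p}. e i * m i s) else e i * m p s)" for i
    have sum: "(\<Sum>i\<in>I. e' i * m i s') = (\<Sum>i\<in>I - {p}. e i * (m p s * m i s' - m i s * m p s'))" for s'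
    proof -
      have "(\<Sum>i\<in>I. e' i * m i s') = e' p * m p s' + (\<Sum>i\<in>I - {p}. e' i * m i s')"
        using p insert.prems by (simp add: sum.remove)
      also have "(\<Sum>i\<in>I - {p}. e' i * m i s') = (\<Sum>i\<in>I - {p}. e i * m p s * m i s')" by (simp add: e'_def)
      also have "e' p * m p s' = - (\<Sum>i\<in>I - {p}. e i * m i s * m p s')" by (simp add: e'_def sum_distrib_right)
      also have "- (\<Sum>i\<in>I - {p}. e i * m i s * m p s') + (\<Sum>i\<in>I - {p}. e i * m p s * m i s')
          = (\<Sum>i\<in>I - {p}. e i * m p s * m i s' - e i * m i s * m p s')" by (simp add: sum_subtractf)
      also have "\<dots> = (\<Sum>i\<in>I - {p}. e i * (m p s * m i s' - m i s * m p s'))" by (simp add: algebra_simps)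
      finally show ?thesis .
    qed
    have "\<exists>i\<in>I. e' i \<noteq> 0" using e(1) p by (auto simp: e'_def)
    moreover have "\<forall>s'\<in>insert s S. (\<Sum>i\<in>I. e' i * m i s') = 0" using e(2) by (auto simp: sum mult.commute)
    ultimately show ?thesis by blast
  qed
qed

section \<open>Independent sequences separated by subgroups\<close>

definition separated_sequence :: "('a, 'b) monoid_scheme \<Rightarrow> 'a set \<Rightarrow> (nat \<Rightarrow> 'a) \<Rightarrow> (nat \<Rightarrow> 'a set) \<Rightarrow> bool" where
  "separated_sequence G N b H \<longleftrightarrow> (\<forall>i. b i \<in> carrier G \<and> subgroup (H i) G \<and> N \<subseteq> H i \<and> (\<forall>j<i. b j \<in> H i) \<and>
     (\<forall>k::nat>0. b i [^]\<^bsub>G\<^esub> k \<notin> H i))"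

context comm_group
begin

text \<open>In a relation all factors before the last lie in the last subgroup, hence so does the
  last factor, which forces its exponent to be 0. The subgroups need not be nested.\<close>

lemma separated_sequence_independent:
  fixes e :: "nat \<Rightarrow> int"
  assumes sep: "separated_sequence G N b H"
  shows "(\<Otimes>i\<in>{..<n}. b i [^] e i) = \<one> \<Longrightarrow> i < n \<Longrightarrow> e i = 0"
proof (induction n arbitrary: i)
  case (Suc n)
  have b: "b i \<in> carrier G" for i using sep by (simp add: separated_sequence_def)
  have H: "subgroup (H i) G" "\<And>j. j < i \<Longrightarrow> b j \<in> H i" "\<And>k::nat. k > 0 \<Longrightarrow> b i [^] k \<notin> H i" for i
    using sep by (auto simp: separated_sequence_def)
  have in_H: "m \<le> n \<Longrightarrow> (\<Otimes>i\<in>{..<m}. b i [^] e i) \<in> H n" for m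
  proof (induction m)
    case 0
    then show ?case using H(1) by (simp add: subgroup.one_closed)
  next
    case (Suc m)
    have "(\<Otimes>i\<in>{..<Suc m}. b i [^] e i) = b m [^] e m \<otimes> (\<Otimes>i\<in>{..<m}. b i [^] e i)"
      unfolding lessThan_Suc using b by (intro finprod_insert) auto
    moreover have "b m [^] e m \<in> H n" using subgroup_int_pow_closed[OF H(1) H(2)] Suc.prems by simp
    ultimately show ?case using Suc subgroup.m_closed[OF H(1)] by simp
  qed
  define P where "P = (\<Otimes>i\<in>{..<n}. b i [^] e i)"
  have P: "P \<in> H n" "P \<in> carrier G" using in_H b by (auto simp: P_def)
  have "(\<Otimes>i\<in>{..<Suc n}. b i [^] e i) = b n [^] e n \<otimes> P"
    unfolding lessThan_Suc P_def using b by (intro finprod_insert) auto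
  then have eq: "b n [^] e n \<otimes> P = \<one>" using Suc.prems by simp
  then have inv: "inv P = b n [^] e n" using P b by (intro inv_equality) auto
  have "e n = 0"
  proof (rule ccontr)
    assume "e n \<noteq> 0"
    obtain l :: nat where l: "e n = int l \<or> e n = - int l" by (metis int_cases2)
    from l have "b n [^] l \<in> H n"
    proof
      assume "e n = int l"
      then have "b n [^] l = inv P" using inv int_pow_int[of G "b n" l] by simp
      then show ?thesis using subgroup.m_inv_closed[OF H(1) P(1)] by (simp only:)
    next
      assume "e n = - int l"
      then have "inv P = inv (b n [^] l)" using inv int_pow_neg_int[OF b, of n l] by simp
      then have "b n [^] l = P" using P(2) b by (metis inv_inv nat_pow_closed)
      then show ?thesis using P(1) by (simp only:)
    qed
    moreover have "l > 0" using l \<open>e n \<noteq> 0\<close> by auto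
    ultimately show False using H(3) by blast
  qed
  moreover have "P = \<one>" using eq \<open>e n = 0\<close> P by simp
  ultimately show ?case using Suc.IH[of i] Suc.prems unfolding P_def by (cases "i = n") auto
qed simp

lemma finprod_int_pow_sum:
  fixes c :: "'i \<Rightarrow> 'a \<Rightarrow> int"
  assumes "finite I" "S \<subseteq> carrier G"
  shows "(\<Otimes>i\<in>I. \<Otimes>s\<in>S. s [^] c i s) = (\<Otimes>s\<in>S. s [^] (\<Sum>i\<in>I. c i s))"
  using assms(1)
proof (induction I)
  case (insert i I)
  have "(\<Otimes>i\<in>insert i I. \<Otimes>s\<in>S. s [^] c i s) = (\<Otimes>s\<in>S. s [^] c i s) \<otimes> (\<Otimes>i\<in>I. \<Otimes>s\<in>S. s [^] c i s)"
    using insert.hyps assms(2) by (intro finprod_insert) (auto intro!: finprod_closed)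
  also have "\<dots> = (\<Otimes>s\<in>S. s [^] c i s \<otimes> s [^] (\<Sum>i\<in>I. c i s))"
    unfolding insert.IH using assms(2) by (intro finprod_multf[symmetric]) auto
  also have "\<dots> = (\<Otimes>s\<in>S. s [^] (\<Sum>i\<in>insert i I. c i s))"
    using insert.hyps assms(2) by (intro finprod_cong') (auto simp: int_pow_mult)
  finally show ?case .
qed simp

lemma finprod_int_pow:
  fixes m :: "'a \<Rightarrow> int"
  assumes "finite S" "S \<subseteq> carrier G"
  shows "(\<Otimes>s\<in>S. s [^] m s) [^] (k::int) = (\<Otimes>s\<in>S. s [^] (m s * k))"
  using assms
proof (induction S)
  case (insert s S)
  have "(\<Otimes>s\<in>insert s S. s [^] m s) = s [^] m s \<otimes> (\<Otimes>s\<in>S. s [^] m s)"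
    using insert by (intro finprod_insert) auto
  moreover have "(\<Otimes>s\<in>insert s S. s [^] (m s * k)) = s [^] (m s * k) \<otimes> (\<Otimes>s\<in>S. s [^] (m s * k))"
    using insert by (intro finprod_insert) auto
  moreover have "(\<Otimes>s\<in>S. s [^] m s) \<in> carrier G" using insert by (intro finprod_closed) auto
  ultimately show ?case using insert by (simp add: int_pow_distrib int_pow_pow)
qed simp

text \<open>A nontrivial relation on \<open>insert x S\<close> must involve \<open>x\<close>, since
  \<open>S\<close> itself is independent; it is solved for the power of \<open>x\<close>.\<close>

lemma maximal_Z_independent_power:
  assumes S: "maximal_Z_independent G S" "finite S" and x: "x \<in> carrier G"
  shows "\<exists>(k::int) m. k \<noteq> 0 \<and> x [^] k = (\<Otimes>s\<in>S. s [^] (m s :: int))"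
proof (cases "x \<in> S")
  case True
  have Sc: "S \<subseteq> carrier G" using S by (simp add: maximal_Z_independent_def Z_independent_def)
  have "(\<Otimes>s\<in>S. s [^] (if s = x then 1 else 0 :: int)) = (\<Otimes>s\<in>S. if x = s then s else \<one>)"
    using Sc by (intro finprod_cong') auto
  also have "\<dots> = x" using finprod_singleton[OF True S(2), of "\<lambda>s. s"] Sc by auto
  finally show ?thesis using x by (intro exI[of _ 1] exI[of _ "\<lambda>s. if s = x then 1 else 0"]) simp
next
  case False
  have Sc: "S \<subseteq> carrier G" and ind: "Z_independent G S" using S by (auto simp: maximal_Z_independent_def Z_independent_def)
  have "\<not> Z_independent G (insert x S)" using S(1) False by (auto simp: maximal_Z_independent_def)
  then obtain T and f :: "'a \<Rightarrow> int" where T: "finite T" "T \<subseteq> insert x S" "(\<Otimes>x\<in>T. x [^] f x) = \<one>" "\<exists>x\<in>T. f x \<noteq> 0"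
    using x Sc unfolding Z_independent_def by auto
  have Tc: "T \<subseteq> carrier G" using T x Sc by auto
  define P where "P = (\<Otimes>s\<in>T - {x}. s [^] f s)"
  have Pc: "P \<in> carrier G" unfolding P_def using Tc by (intro finprod_closed) auto
  have indT: "\<forall>s\<in>T - {x}. f s = 0" if "P = \<one>"
    using ind that T unfolding Z_independent_def P_def by blast
  have xT: "x \<in> T"
  proof (rule ccontr)
    assume "x \<notin> T"
    then have "T - {x} = T" by auto
    then show False using T indT unfolding P_def by auto
  qed
  have "(\<Otimes>s\<in>insert x (T - {x}). s [^] f s) = x [^] f x \<otimes> P" unfolding P_def
    using T Tc xT by (intro finprod_insert) auto
  moreover have "insert x (T - {x}) = T" using xT by auto
  ultimately have eq: "x [^] f x \<otimes> P = \<one>" using T(3) by simp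
  have fx: "f x \<noteq> 0"
  proof
    assume "f x = 0"
    then show False using eq Pc indT T(4) by auto
  qed
  have PS: "P = (\<Otimes>s\<in>S. s [^] (if s \<in> T then f s else 0))" unfolding P_def
    using T Sc False S(2) by (intro finprod_mono_neutral_cong_left) auto
  have "x [^] (- f x) = inv (x [^] f x)" using x by (simp add: int_pow_neg)
  also have "\<dots> = P" using eq Pc x by (intro inv_equality) (auto simp: m_comm)
  finally show ?thesis using PS fx by (intro exI[of _ "- f x"] exI[of _ "\<lambda>s. if s \<in> T then f s else 0"]) simp
qed

text \<open>If \<open>S\<close> is finite, suitable nonzero powers of \<open>card S\<close> + 1
  members of the sequence are products of powers of elements of \<open>S\<close>; a linear
  dependence between the exponent vectors is then a relation that the sequence does not
  admit.\<close>

lemma separated_sequence_imp_infinite: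
  assumes sep: "separated_sequence G N b H" and S: "maximal_Z_independent G S"
  shows "infinite S"
proof
  assume fin: "finite S"
  have Sc: "S \<subseteq> carrier G" using S by (simp add: maximal_Z_independent_def Z_independent_def)
  have b: "b i \<in> carrier G" for i using sep by (simp add: separated_sequence_def)
  have "\<forall>i. \<exists>(k::int) m. k \<noteq> 0 \<and> b i [^] k = (\<Otimes>s\<in>S. s [^] (m s :: int))"
    using maximal_Z_independent_power[OF S fin b] by blast
  then obtain k :: "nat \<Rightarrow> int" and m :: "nat \<Rightarrow> 'a \<Rightarrow> int"
    where km: "\<And>i. k i \<noteq> 0" "\<And>i. b i [^] k i = (\<Otimes>s\<in>S. s [^] m i s)" by metis
  let ?I = "{..<Suc (card S)}"
  obtain e where e: "\<exists>i\<in>?I. e i \<noteq> 0" "\<forall>s\<in>S. (\<Sum>i\<in>?I. e i * m i s) = 0"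
    using int_linear_dependence[OF fin, of ?I m] by auto
  have "(\<Otimes>i\<in>?I. b i [^] (k i * e i)) = (\<Otimes>i\<in>?I. \<Otimes>s\<in>S. s [^] (m i s * e i))"
  proof (rule finprod_cong')
    show "(\<lambda>i. \<Otimes>s\<in>S. s [^] (m i s * e i)) \<in> ?I \<rightarrow> carrier G" using Sc by (auto intro!: finprod_closed)
    show "b i [^] (k i * e i) = (\<Otimes>s\<in>S. s [^] (m i s * e i))" for i
      using finprod_int_pow[OF fin Sc, of "m i" "e i"] km(2)[of i] b by (simp flip: int_pow_pow)
  qed simp
  also have "\<dots> = (\<Otimes>s\<in>S. s [^] (\<Sum>i\<in>?I. m i s * e i))" by (rule finprod_int_pow_sum[OF _ Sc]) simp
  also have "\<dots> = \<one>" using e(2) Sc by (intro finprod_one_eqI) (simp add: mult.commute)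
  finally have "k i * e i = 0" if "i < Suc (card S)" for i
    using separated_sequence_independent[OF sep, of "\<lambda>i. k i * e i" "Suc (card S)" i] that by blast
  then show False using e(1) km(1) by auto
qed

lemma rational_rank_zero_or_infinite:
  assumes "\<And>x. x \<in> carrier G \<Longrightarrow> (\<And>k::nat. k > 0 \<Longrightarrow> x [^] k \<noteq> \<one>) \<Longrightarrow> \<exists>N b H. separated_sequence G N b H"
  shows "rational_rank G =o (czero :: 'a rel) \<or> cinfinite (rational_rank G)"
proof -
  define S where "S = (SOME S. maximal_Z_independent G S)"
  have S: "maximal_Z_independent G S" unfolding S_def using maximal_Z_independent_exists by (rule someI_ex)
  have r: "rational_rank G = |S|" by (simp add: rational_rank_def S_def)
  show ?thesis
  proof (cases "S = {}")
    case True
    then show ?thesis unfolding r czero_def by (simp add: card_of_refl)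
  next
    case False
    then obtain x where x: "x \<in> S" by auto
    have ind: "Z_independent G S" using S by (simp add: maximal_Z_independent_def)
    then have xc: "x \<in> carrier G" using x by (auto simp: Z_independent_def)
    have "x [^] k \<noteq> \<one>" if "k > 0" for k :: nat
    proof
      assume "x [^] k = \<one>"
      then have "(\<Otimes>y\<in>{x}. y [^] ((\<lambda>_. int k) y)) = \<one>" using xc by (simp add: int_pow_int)
      then have "int k = 0"
        using ind[unfolded Z_independent_def, THEN conjunct2, rule_format, of "{x}" "\<lambda>_. int k" x] x by simp
      then show False using that by simp
    qed
    then obtain N b H where "separated_sequence G N b H" using assms[OF xc] by blast
    then have "infinite S" by (rule separated_sequence_imp_infinite[OF _ S])
    then show ?thesis unfolding r cinfinite_def Field_card_of by simp
  qed
qed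

text \<open>As \<open>N\<close> lies in each \<open>H i\<close>, each \<open>H i\<close> is a union
  of cosets of \<open>N\<close>; its image in the quotient therefore still excludes the positive
  powers of the image of \<open>b i\<close>.\<close>

lemma rational_rank_Mod_zero_or_infinite:
  assumes N: "subgroup N G"
    and sep: "\<And>x. x \<in> carrier G \<Longrightarrow> (\<And>k::nat. k > 0 \<Longrightarrow> x [^] k \<notin> N) \<Longrightarrow> \<exists>b H. separated_sequence G N b H"
  shows "rational_rank (G Mod N) =o (czero :: 'a set rel) \<or> cinfinite (rational_rank (G Mod N))"
proof -
  interpret N: normal N G using N by (rule subgroup_imp_normal)
  interpret Q: comm_group "G Mod N" by (rule abelian_FactGroup[OF N])
  interpret h: group_hom G "G Mod N" "\<lambda>a. N #> a"
    by (intro group_hom.intro group_hom_axioms.intro N.r_coset_hom_Mod) (unfold_locales)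
  have coset: "\<exists>n\<in>N. x = n \<otimes> y" if "N #> x = N #> y" "x \<in> carrier G" "y \<in> carrier G" for x y
  proof -
    have "x \<in> N #> y" using rcos_self[OF that(2) N] that(1) by simp
    then show ?thesis by (auto simp: r_coset_def)
  qed
  show ?thesis
  proof (rule Q.rational_rank_zero_or_infinite)
    fix Y assume Y: "Y \<in> carrier (G Mod N)" "\<And>k::nat. k > 0 \<Longrightarrow> Y [^]\<^bsub>G Mod N\<^esub> k \<noteq> \<one>\<^bsub>G Mod N\<^esub>"
    then obtain x where x: "x \<in> carrier G" "Y = N #> x" by (auto simp: FactGroup_def RCOSETS_def)
    have "x [^] k \<notin> N" if "k > 0" for k :: nat
    proof
      assume "x [^] k \<in> N"
      then have "N #> (x [^] k) = N" using coset_join2[OF _ N] x by simp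
      then show False using Y(2)[OF that] x h.hom_nat_pow[OF x(1), of k] by (simp add: FactGroup_def)
    qed
    then obtain b H where s: "separated_sequence G N b H" using sep x by blast
    have "separated_sequence (G Mod N) {} (\<lambda>i. N #> b i) (\<lambda>i. (\<lambda>a. N #> a) ` H i)"
      unfolding separated_sequence_def
    proof (intro allI conjI impI)
      fix i
      have i: "b i \<in> carrier G" "subgroup (H i) G" "N \<subseteq> H i" "\<And>j. j < i \<Longrightarrow> b j \<in> H i" "\<And>k::nat. k > 0 \<Longrightarrow> b i [^] k \<notin> H i"
        using s by (auto simp: separated_sequence_def)
      show "N #> b i \<in> carrier (G Mod N)" using i(1) by (rule h.hom_closed)
      show "subgroup ((\<lambda>a. N #> a) ` H i) (G Mod N)" by (rule h.subgroup_img_is_subgroup[OF i(2)])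
      show "N #> b j \<in> (\<lambda>a. N #> a) ` H i" if "j < i" for j using i(4)[OF that] by (rule imageI)
      show "(N #> b i) [^]\<^bsub>G Mod N\<^esub> k \<notin> (\<lambda>a. N #> a) ` H i" if "k > 0" for k :: nat
      proof
        assume "(N #> b i) [^]\<^bsub>G Mod N\<^esub> k \<in> (\<lambda>a. N #> a) ` H i"
        then obtain a where a: "a \<in> H i" "N #> (b i [^] k) = N #> a" using h.hom_nat_pow[OF i(1), of k] by auto
        then obtain n where "n \<in> N" "b i [^] k = n \<otimes> a" using coset subgroup.mem_carrier[OF i(2)] i(1) by (metis nat_pow_closed)
        then have "b i [^] k \<in> H i" using i(3) a subgroup.m_closed[OF i(2)] by auto
        then show False using i(5) that by blast
      qed
    qed auto
    then show "\<exists>N' b H. separated_sequence (G Mod N) N' b H" by blast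
  qed
qed

end

section \<open>Multiplicative groups of fields\<close>

lemma finite_set_choice_sequence:
  assumes "\<And>Z. finite Z \<Longrightarrow> Z \<subseteq> C \<Longrightarrow> \<exists>c\<in>C. \<Phi> Z c"
  shows "\<exists>c :: nat \<Rightarrow> 'a. \<forall>i. c i \<in> C \<and> \<Phi> (c ` {..<i}) (c i)"
proof -
  obtain g where g: "\<And>Z. finite Z \<Longrightarrow> Z \<subseteq> C \<Longrightarrow> g Z \<in> C \<and> \<Phi> Z (g Z)" using assms by metis
  define s where "s = rec_nat {} (\<lambda>_ Z. insert (g Z) Z)"
  define c where "c i = g (s i)" for i :: nat
  have s: "s 0 = {}" "\<And>i. s (Suc i) = insert (c i) (s i)" by (simp_all add: s_def c_def)
  have "s i = c ` {..<i}" for i by (induction i) (auto simp: s lessThan_Suc)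
  moreover have "finite (s i) \<and> s i \<subseteq> C" for i
  proof (induction i)
    case (Suc i)
    then show ?case using g[of "s i"] by (simp add: s c_def)
  qed (simp add: s)
  ultimately show ?thesis using g c_def by (intro exI[of _ c]) metis
qed

text \<open>The subgroups are pulled back along \<open>h\<close>. This brings a sequence found in an
  algebraic closure back to the given field.\<close>

lemma separated_sequence_vimage:
  assumes h: "group_hom G G' h" and b: "\<And>i. b i \<in> carrier G" and N: "N \<subseteq> carrier G" "h ` N \<subseteq> N'"
    and sep: "separated_sequence G' N' (\<lambda>i. h (b i)) H"
  shows "separated_sequence G N b (\<lambda>i. {x \<in> carrier G. h x \<in> H i})"
proof -
  interpret h: group_hom G G' h by (rule h)
  show ?thesis unfolding separated_sequence_def
  proof (intro allI conjI impI)
    fix i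
    have i: "subgroup (H i) G'" "N' \<subseteq> H i" "\<And>j. j < i \<Longrightarrow> h (b j) \<in> H i" "\<And>k::nat. k > 0 \<Longrightarrow> h (b i) [^]\<^bsub>G'\<^esub> k \<notin> H i"
      using sep by (auto simp: separated_sequence_def)
    show "b i \<in> carrier G" by (rule b)
    show "N \<subseteq> {x \<in> carrier G. h x \<in> H i}" using N i(2) by auto
    show "b j \<in> {x \<in> carrier G. h x \<in> H i}" if "j < i" for j using i(3)[OF that] b by simp
    show "b i [^]\<^bsub>G\<^esub> k \<notin> {x \<in> carrier G. h x \<in> H i}" if "k > 0" for k :: nat
      using i(4)[OF that] h.hom_nat_pow[OF b] by simp
    show "subgroup {x \<in> carrier G. h x \<in> H i} G"
      by (rule h.G.subgroupI)
        (use i(1) h.H.subgroup_self subgroup.one_closed[OF i(1)] in \<open>auto simp: subgroup.m_closed subgroup.m_inv_closed intro!: exI[of _ "\<one>\<^bsub>G\<^esub>"]\<close>)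
  qed
qed

context field
begin

section \<open>Unit groups of valuation rings\<close>

lemma mult_of_comm_group: "comm_group (mult_of R)"
  unfolding mult_of_is_Units by (rule units_comm_group)

definition unit_set :: "'a set \<Rightarrow> 'a set" where
  "unit_set V = {x \<in> V. x \<noteq> \<zero> \<and> inv x \<in> V}"

lemma unit_set_mono: "V \<subseteq> W \<Longrightarrow> unit_set V \<subseteq> unit_set W"
  by (auto simp: unit_set_def)

lemma unit_set_subfield: "subfield F R \<Longrightarrow> unit_set F = F - {\<zero>}"
  using subfield_m_inv(1) by (auto simp: unit_set_def)

lemma unit_set_mult: "subring V R \<Longrightarrow> x \<in> unit_set V \<Longrightarrow> y \<in> unit_set V \<Longrightarrow> x \<otimes> y \<in> unit_set V"
  using subringE(1)[of V R] subringE(6)[of V R]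
  by (auto simp: unit_set_def integral_iff nonzero_inverse_mult_distrib subset_iff)

lemma unit_set_inv: "subring V R \<Longrightarrow> x \<in> unit_set V \<Longrightarrow> inv x \<in> unit_set V"
  using subringE(1)[of V R] by (auto simp: unit_set_def nonzero_inverse_inverse_eq nonzero_imp_inverse_nonzero subset_iff)

lemma unit_set_one: "subring V R \<Longrightarrow> \<one> \<in> unit_set V"
  using subringE(3)[of V R] by (simp add: unit_set_def)

lemma subgroup_mult_ofI:
  assumes "H \<subseteq> carrier R - {\<zero>}" "\<one> \<in> H" "\<And>x y. x \<in> H \<Longrightarrow> y \<in> H \<Longrightarrow> x \<otimes> y \<in> H" "\<And>x. x \<in> H \<Longrightarrow> inv x \<in> H"
  shows "subgroup H (mult_of R)"
  by (rule group.subgroupI[OF field_mult_group]) (use assms in \<open>auto simp: m_inv_mult_of subset_iff\<close>)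

lemma pow_notin_unit_set:
  assumes V: "valuation_ring V" and x: "x \<in> carrier R" "x \<noteq> \<zero>" "inv x \<notin> V" and k: "k > 0"
  shows "x [^] (k::nat) \<notin> unit_set V"
proof
  assume "x [^] k \<in> unit_set V"
  then have i: "inv (x [^] k) \<in> V" by (simp add: unit_set_def)
  have xV: "x \<in> V" using valuation_ring_total[OF V x(1,2)] x(3) by blast
  obtain l where l: "k = Suc l" using k by (cases k) auto
  have c: "x [^] l \<in> carrier R" "x [^] l \<noteq> \<zero>" "inv (x [^] l) \<in> carrier R" using x by auto
  have "x [^] l \<otimes> inv (x [^] k) = inv x \<otimes> (x [^] l \<otimes> inv (x [^] l))"
    using c x by (simp add: l nonzero_inverse_mult_distrib m_ac del: r_inv l_inv)
  then have "inv x = x [^] l \<otimes> inv (x [^] k)" using c x by simp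
  also have "\<dots> \<in> V" using subringE(6)[OF valuation_ring_subring[OF V]] i nat_pow_in_subring[OF valuation_ring_subring[OF V] xV] by blast
  finally show False using x by blast
qed

text \<open>A valuation ring is local. With g = d - e, one of g/d and d/g lies in \<open>V\<close>;
  the first would make \<open>d\<close> a unit, the second makes \<open>g\<close> one.\<close>

lemma valuation_ring_nonunit_minus_unit:
  assumes V: "valuation_ring V" and d: "d \<in> carrier R" "d \<noteq> \<zero>" "inv d \<notin> V" and e: "e \<in> unit_set V"
  shows "d \<ominus> e \<in> unit_set V"
proof -
  note VS = valuation_ring_subring[OF V]
  note VE = subringE[OF VS]
  have dV: "d \<in> V" using valuation_ring_total[OF V d(1,2)] d(3) by blast
  have e': "e \<in> V" "e \<noteq> \<zero>" "inv e \<in> V" "e \<in> carrier R" "inv e \<in> carrier R" using e VE(1) by (auto simp: unit_set_def)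
  define g where "g = d \<ominus> e"
  have g: "g \<in> V" "g \<in> carrier R" using subring_minus_closed[OF VS dV e'(1)] d e' by (auto simp: g_def)
  have g0: "g \<noteq> \<zero>" using d e' by (auto simp: g_def)
  have "inv g \<in> V"
  proof (rule ccontr)
    assume ig: "inv g \<notin> V"
    have di: "inv d \<in> carrier R" "inv d \<noteq> \<zero>" using d nonzero_imp_inverse_nonzero by auto
    have gi: "inv g \<in> carrier R" "inv g \<noteq> \<zero>" using g g0 nonzero_imp_inverse_nonzero by auto
    have "g \<otimes> inv d \<in> carrier R" "g \<otimes> inv d \<noteq> \<zero>" using g g0 di by (auto simp: integral_iff)
    then consider "g \<otimes> inv d \<in> V" | "inv (g \<otimes> inv d) \<in> V" using valuation_ring_total[OF V] by blast
    then show False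
    proof cases
      case 1
      have "inv d = inv e \<otimes> (e \<otimes> inv d)" using e' di by (simp flip: m_assoc)
      also have "e \<otimes> inv d = d \<otimes> inv d \<ominus> g \<otimes> inv d" unfolding g_def using d(1) e'(4) di(1) by algebra
      also have "\<dots> = \<one> \<ominus> g \<otimes> inv d" using d by simp
      finally have "inv d = inv e \<otimes> (\<one> \<ominus> g \<otimes> inv d)" .
      moreover have "inv e \<otimes> (\<one> \<ominus> g \<otimes> inv d) \<in> V" using VE(6)[OF e'(3) subring_minus_closed[OF VS VE(3) 1]] .
      ultimately show False using d(3) by simp
    next
      case 2
      have "inv (g \<otimes> inv d) = d \<otimes> inv g"
        using g g0 di d by (simp add: nonzero_inverse_mult_distrib nonzero_inverse_inverse_eq)
      then have dg: "d \<otimes> inv g \<in> V" using 2 by simp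
      have "inv g = inv e \<otimes> (e \<otimes> inv g)" using e' gi by (simp flip: m_assoc)
      also have "e \<otimes> inv g = d \<otimes> inv g \<ominus> g \<otimes> inv g" unfolding g_def using d(1) e'(4) gi(1)[unfolded g_def] by algebra
      also have "\<dots> = d \<otimes> inv g \<ominus> \<one>" using g g0 by simp
      finally have "inv g = inv e \<otimes> (d \<otimes> inv g \<ominus> \<one>)" .
      moreover have "inv e \<otimes> (d \<otimes> inv g \<ominus> \<one>) \<in> V" using VE(6)[OF e'(3) subring_minus_closed[OF VS dg VE(3)]] .
      ultimately show False using ig by simp
    qed
  qed
  then show ?thesis using g g0 by (simp add: unit_set_def g_def)
qed

text \<open>The common outcome of the transcendental and the algebraic case. By totality a - c
  itself belongs to \<open>V\<close>, so it is a nonzero nonunit. \<open>E\<close> records a subring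
  whose units stay units in every \<open>V\<close>: the prime ring, or the base field of the
  extension when an element transcendental over it is available.\<close>

definition separable_by_valuations :: "'a set \<Rightarrow> 'a set \<Rightarrow> bool" where
  "separable_by_valuations E F \<longleftrightarrow> (\<forall>a Z. a \<in> carrier R \<and> (algebraic over F) a \<and> finite Z \<and> Z \<subseteq> carrier R - {\<zero>} \<and>
     (\<forall>z\<in>Z. (algebraic over F) z) \<longrightarrow>
     (\<exists>c\<in>F. \<exists>V. valuation_ring V \<and> E \<subseteq> V \<and> a \<noteq> c \<and> inv (a \<ominus> c) \<notin> V \<and> Z \<subseteq> unit_set V))"

lemma separable_by_valuations_transcendental:
  assumes E0: "subring E0 R" and F: "subfield F R" "E0 \<subseteq> F" and t: "t \<in> F" "(transcendental over E0) t"
  shows "separable_by_valuations E0 F"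
proof -
  obtain E where E: "subfield E R" "E0 \<subseteq> E" "E \<subseteq> F" "(transcendental over E) t"
    "\<And>z. z \<in> F \<Longrightarrow> (algebraic over (simple_extension E t)) z"
    using exists_maximal_transcendental_subfield[OF assms] by blast
  show ?thesis unfolding separable_by_valuations_def
  proof (intro allI impI, elim conjE)
    fix a Z assume *: "a \<in> carrier R" "(algebraic over F) a" "finite Z" "Z \<subseteq> carrier R - {\<zero>}" "\<forall>z\<in>Z. (algebraic over F) z"
    then obtain c V where "c \<in> F" "valuation_ring V" "E \<subseteq> V" "a \<noteq> c" "inv (a \<ominus> c) \<notin> V" "\<forall>z\<in>Z. z \<in> V \<and> inv z \<in> V"
      using separating_valuation_ring_transcendental[OF E(1) F(1) E(3) t(1) E(4,5) *(1-4)] by blast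
    then show "\<exists>c\<in>F. \<exists>V. valuation_ring V \<and> E0 \<subseteq> V \<and> a \<noteq> c \<and> inv (a \<ominus> c) \<notin> V \<and> Z \<subseteq> unit_set V"
      using E(2) *(4) by (intro bexI[of _ c] exI[of _ V]) (auto simp: unit_set_def)
  qed
qed

text \<open>Either some element of \<open>F\<close> is transcendental over the prime ring, or
  \<open>F\<close> is algebraic over it. In the second case \<open>x\<close> is algebraic over the
  prime ring without being a root of unity, which rules out positive characteristic.\<close>

lemma separable_by_valuations_prime_ring:
  assumes F: "subfield F R" and x: "x \<in> carrier R" "x \<noteq> \<zero>" "(algebraic over F) x" "\<And>k::nat. k > 0 \<Longrightarrow> x [^] k \<noteq> \<one>"
  shows "separable_by_valuations prime_ring F"
proof (cases "\<exists>t\<in>F. (transcendental over prime_ring) t")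
  case True
  then show ?thesis
    using separable_by_valuations_transcendental[OF prime_ring_subring F prime_ring_le[OF subfieldE(1)[OF F]]] by blast
next
  case False
  then have alg: "(algebraic over prime_ring) z" if "z \<in> F" for z using that by (auto simp: over_def)
  have ch: "n = 0" if "\<guillemotleft>n\<guillemotright> = \<zero>" for n
    using algebraic_over_prime_ring_torsion[OF that _ x(1,2) algebraic_over_prime_ring_trans[OF F alg x(1,3)]] x(4) by blast
  show ?thesis unfolding separable_by_valuations_def
  proof (intro allI impI, elim conjE)
    fix a Z assume *: "a \<in> carrier R" "(algebraic over F) a" "finite Z" "Z \<subseteq> carrier R - {\<zero>}" "\<forall>z\<in>Z. (algebraic over F) z"
    then obtain c V where "c \<in> F" "valuation_ring V" "a \<noteq> c" "inv (a \<ominus> c) \<notin> V" "\<forall>z\<in>Z. z \<in> V \<and> inv z \<in> V"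
      using separating_valuation_ring_prime_ring[OF ch F alg *(1-4)] by blast
    then show "\<exists>c\<in>F. \<exists>V. valuation_ring V \<and> prime_ring \<subseteq> V \<and> a \<noteq> c \<and> inv (a \<ominus> c) \<notin> V \<and> Z \<subseteq> unit_set V"
      using *(4) prime_ring_le[OF valuation_ring_subring] by (intro bexI[of _ c] exI[of _ V]) (auto simp: unit_set_def)
  qed
qed

text \<open>The choice a = 0 yields successive constants, each a nonunit of a valuation ring in
  which the earlier ones are units; the subgroups are the unit groups of these rings.\<close>

lemma separated_sequence_of_constants:
  assumes sep: "separable_by_valuations E F" and F: "subfield F R"
  shows "\<exists>b H. separated_sequence (mult_of R) (unit_set E) b H"
proof -
  note FS = subfieldE(1)[OF F]
  note FE = subringE[OF FS]
  define \<Phi> where "\<Phi> Z c \<longleftrightarrow> (\<exists>V. valuation_ring V \<and> E \<subseteq> V \<and> inv c \<notin> V \<and> Z \<subseteq> unit_set V)" for Z c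
  have "\<exists>c\<in>F - {\<zero>}. \<Phi> Z c" if Z: "finite Z" "Z \<subseteq> F - {\<zero>}" for Z
  proof -
    have "(algebraic over F) \<zero>" "\<forall>z\<in>Z. (algebraic over F) z" using algebraic_self[OF FS] zero_is_algebraic[OF FS] Z by auto
    moreover have "Z \<subseteq> carrier R - {\<zero>}" using Z FE by auto
    ultimately obtain c V where cV: "c \<in> F" "valuation_ring V" "E \<subseteq> V" "\<zero> \<noteq> c" "inv (\<zero> \<ominus> c) \<notin> V" "Z \<subseteq> unit_set V"
      using sep Z(1) unfolding separable_by_valuations_def by (meson zero_closed)
    have c: "c \<in> carrier R" "inv c \<in> carrier R" using cV FE by auto
    have "inv (\<zero> \<ominus> c) = \<ominus> (inv c)"
    proof -
      have "(\<ominus> c) \<otimes> (\<ominus> (inv c)) = \<one>" using c cV(4) by (simp add: l_minus r_minus)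
      then show ?thesis using c by (simp add: comm_inv_char)
    qed
    then have "inv c \<notin> V" using cV(5) subringE(5)[OF valuation_ring_subring[OF cV(2)]] by auto
    then show ?thesis using cV unfolding \<Phi>_def by blast
  qed
  then obtain b where b: "\<And>i::nat. b i \<in> F - {\<zero>}" "\<And>i. \<Phi> (b ` {..<i}) (b i)"
    using finite_set_choice_sequence[of "F - {\<zero>}" \<Phi>] by blast
  then obtain V where V: "\<And>i. valuation_ring (V i)" "\<And>i. E \<subseteq> V i" "\<And>i. inv (b i) \<notin> V i" "\<And>i. b ` {..<i} \<subseteq> unit_set (V i)"
    unfolding \<Phi>_def by metis
  have "separated_sequence (mult_of R) (unit_set E) b (\<lambda>i. unit_set (V i))"
    unfolding separated_sequence_def
  proof (intro allI conjI impI)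
    fix i
    note VS = valuation_ring_subring[OF V(1)[of i]]
    show "b i \<in> carrier (mult_of R)" using b(1)[of i] FE(1) by auto
    show "subgroup (unit_set (V i)) (mult_of R)"
      by (rule subgroup_mult_ofI) (use unit_set_mult[OF VS] unit_set_inv[OF VS] unit_set_one[OF VS] subringE(1)[OF VS] in \<open>auto simp: unit_set_def\<close>)
    show "unit_set E \<subseteq> unit_set (V i)" by (rule unit_set_mono[OF V(2)])
    show "b j \<in> unit_set (V i)" if "j < i" for j using V(4) that by auto
    show "b i [^]\<^bsub>mult_of R\<^esub> k \<notin> unit_set (V i)" if "k > 0" for k :: nat
      unfolding Multiplicative_Group.nat_pow_mult_of using pow_notin_unit_set[OF V(1) _ _ V(3) that] b(1)[of i] FE(1) by auto
  qed
  then show ?thesis by blast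
qed

lemma rational_rank_mult_of_zero_or_infinite:
  "rational_rank (mult_of R) =o (czero :: 'a rel) \<or> cinfinite (rational_rank (mult_of R))"
proof (rule comm_group.rational_rank_zero_or_infinite[OF mult_of_comm_group])
  fix x assume x: "x \<in> carrier (mult_of R)" "\<And>k::nat. k > 0 \<Longrightarrow> x [^]\<^bsub>mult_of R\<^esub> k \<noteq> \<one>\<^bsub>mult_of R\<^esub>"
  then have "separable_by_valuations prime_ring (carrier R)"
    using separable_by_valuations_prime_ring[OF carrier_is_subfield, of x] algebraic_self[OF carrier_is_subring]
    by (auto simp: Multiplicative_Group.nat_pow_mult_of)
  then show "\<exists>N b H. separated_sequence (mult_of R) N b H"
    using separated_sequence_of_constants[OF _ carrier_is_subfield] by blast
qed


text \<open>The graph of the \<open>F\<close>-homomorphism from \<open>F[x]\<close> sending \<open>x\<close> to \<open>y\<close>.\<close>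

definition conjugate_pair :: "'a set \<Rightarrow> 'a \<Rightarrow> 'a \<Rightarrow> 'a \<Rightarrow> 'a \<Rightarrow> bool" where
  "conjugate_pair F x y w v \<longleftrightarrow> (\<exists>p\<in>carrier (F [X]). w = eval p x \<and> v = eval p y)"

section \<open>Quotients of elements of F(x) by their conjugates\<close>

context
  fixes F x y
  assumes F: "subfield F R" and x: "x \<in> carrier R" "(algebraic over F) x" and y: "y \<in> carrier R"
    and conj: "\<And>p. p \<in> carrier (F [X]) \<Longrightarrow> eval p x = \<zero> \<Longrightarrow> eval p y = \<zero>"
begin

lemmas base_subring = subfieldE(1)[OF F]

lemma conjugate_pair_carrier: "conjugate_pair F x y w v \<Longrightarrow> w \<in> carrier R \<and> v \<in> carrier R"
  using eval_poly_in_carrier[OF base_subring] x y by (auto simp: conjugate_pair_def univ_poly_carrier)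

lemma conjugate_pair_const:
  assumes "c \<in> F" shows "conjugate_pair F x y c c"
proof -
  have c: "c \<in> carrier R" using assms subringE(1)[OF base_subring] by auto
  have "normalize [c] \<in> carrier (F [X])" using normalize_gives_polynomial[of "[c]" F] assms by (simp add: univ_poly_carrier)
  moreover have "eval (normalize [c]) z = c" if "z \<in> carrier R" for z using eval_normalize[of "[c]" z] c that by simp
  ultimately show ?thesis using x y unfolding conjugate_pair_def by metis
qed

lemma conjugate_pair_var: "conjugate_pair F x y x y"
proof -
  have "[\<one>, \<zero>] \<in> carrier (F [X])" using subringE(2,3)[OF base_subring] by (auto simp: univ_poly_def polynomial_def)
  then show ?thesis using x y unfolding conjugate_pair_def by (intro bexI[of _ "[\<one>, \<zero>]"]) auto
qed

lemma conjugate_pair_mult: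
  assumes "conjugate_pair F x y w v" "conjugate_pair F x y w' v'"
  shows "conjugate_pair F x y (w \<otimes> w') (v \<otimes> v')"
proof -
  interpret P: ring "F [X]" by (rule univ_poly_is_ring[OF base_subring])
  obtain p q where "p \<in> carrier (F [X])" "q \<in> carrier (F [X])" "w = eval p x" "v = eval p y" "w' = eval q x" "v' = eval q y"
    using assms by (auto simp: conjugate_pair_def)
  then show ?thesis using ring_hom_mult[OF eval_is_hom[OF base_subring]] x y unfolding conjugate_pair_def
    by (intro bexI[of _ "p \<otimes>\<^bsub>F [X]\<^esub> q"]) auto
qed

lemma conjugate_pair_minus:
  assumes "conjugate_pair F x y w v" "conjugate_pair F x y w' v'"
  shows "conjugate_pair F x y (w \<ominus> w') (v \<ominus> v')"
proof -
  interpret P: ring "F [X]" by (rule univ_poly_is_ring[OF base_subring])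
  obtain p q where pq: "p \<in> carrier (F [X])" "q \<in> carrier (F [X])" "w = eval p x" "v = eval p y" "w' = eval q x" "v' = eval q y"
    using assms by (auto simp: conjugate_pair_def)
  have "eval (p \<ominus>\<^bsub>F [X]\<^esub> q) z = eval p z \<ominus> eval q z" if "z \<in> carrier R" for z
  proof -
    interpret h: ring_hom_ring "F [X]" R "\<lambda>p. eval p z" by (rule eval_ring_hom[OF base_subring that])
    show ?thesis using pq by (simp add: P.minus_eq minus_eq)
  qed
  then show ?thesis using pq x y unfolding conjugate_pair_def
    by (intro bexI[of _ "p \<ominus>\<^bsub>F [X]\<^esub> q"]) auto
qed

text \<open>Subtracting the two pairs reduces the claim to a pair with first entry 0, where the
  conjugacy of \<open>x\<close> and \<open>y\<close> applies.\<close>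

lemma conjugate_pair_unique:
  assumes "conjugate_pair F x y w v" "conjugate_pair F x y w v'"
  shows "v = v'"
proof -
  have c: "w \<in> carrier R" "v \<in> carrier R" "v' \<in> carrier R" using assms conjugate_pair_carrier by auto
  have "conjugate_pair F x y (w \<ominus> w) (v \<ominus> v')" by (rule conjugate_pair_minus[OF assms])
  then obtain p where p: "p \<in> carrier (F [X])" "w \<ominus> w = eval p x" "v \<ominus> v' = eval p y"
    unfolding conjugate_pair_def by blast
  moreover have "w \<ominus> w = \<zero>" using c(1) by simp
  ultimately have "v \<ominus> v' = \<zero>" using conj[OF p(1)] by metis
  then show ?thesis using c by simp
qed

text \<open>F[x] is a field as \<open>x\<close> is algebraic, so \<open>inv w\<close> has a partner;
  its product with \<open>v\<close> is paired with 1 and hence equals 1.\<close>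

lemma conjugate_pair_inv:
  assumes wv: "conjugate_pair F x y w v" and w: "w \<noteq> \<zero>"
  shows "v \<noteq> \<zero> \<and> conjugate_pair F x y (inv w) (inv v)"
proof -
  have c: "w \<in> carrier R" "v \<in> carrier R" using conjugate_pair_carrier[OF wv] by auto
  have K: "subfield (simple_extension F x) R" using simple_extension_is_subfield[OF F x(1)] x(2) by simp
  have img: "simple_extension F x = (\<lambda>p. eval p x) ` carrier (F [X])"
    by (rule simple_extension_as_eval_img[OF subringE(1)[OF base_subring] x(1)])
  have "w \<in> simple_extension F x" using wv img by (auto simp: conjugate_pair_def)
  then have "inv w \<in> simple_extension F x" using subfield_m_inv(1)[OF K] w by auto
  then obtain u where u: "conjugate_pair F x y (inv w) u" unfolding img conjugate_pair_def by auto
  have uc: "u \<in> carrier R" using conjugate_pair_carrier[OF u] by auto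
  have "conjugate_pair F x y \<one> (v \<otimes> u)" using conjugate_pair_mult[OF wv u] c w by simp
  moreover have "conjugate_pair F x y \<one> \<one>" using conjugate_pair_const subringE(3)[OF base_subring] by blast
  ultimately have vu: "v \<otimes> u = \<one>" using conjugate_pair_unique by blast
  then have "v \<noteq> \<zero>" using uc by auto
  moreover have "inv v = u" using vu c uc by (simp add: comm_inv_char)
  ultimately show ?thesis using u by simp
qed

lemma conjugate_pair_pow: "conjugate_pair F x y w v \<Longrightarrow> conjugate_pair F x y (w [^] (k::nat)) (v [^] k)"
  by (induction k) (auto intro: conjugate_pair_mult conjugate_pair_const subringE(3)[OF base_subring])

text \<open>With sigma the \<open>F\<close>-embedding of F(x) that sends \<open>x\<close> to
  \<open>y\<close>, this is the preimage of the unit group under the homomorphism taking w to w /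
  sigma(w).\<close>

lemma subgroup_conjugate_ratio:
  assumes V: "subring V R"
  shows "subgroup {w \<in> carrier R - {\<zero>}. \<exists>v. conjugate_pair F x y w v \<and> w \<otimes> inv v \<in> unit_set V} (mult_of R)" (is "subgroup ?H _")
proof (rule subgroup_mult_ofI)
  show "\<one> \<in> ?H" using unit_set_one[OF V] conjugate_pair_const[OF subringE(3)[OF base_subring]] by force
  fix w assume w: "w \<in> ?H"
  then obtain v where v: "conjugate_pair F x y w v" "w \<otimes> inv v \<in> unit_set V" by auto
  have c: "w \<in> carrier R" "w \<noteq> \<zero>" "v \<in> carrier R" "v \<noteq> \<zero>" "inv v \<in> carrier R" "inv v \<noteq> \<zero>"
    using w conjugate_pair_carrier[OF v(1)] conjugate_pair_inv[OF v(1)] nonzero_imp_inverse_nonzero by auto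
  have "inv (w \<otimes> inv v) = inv w \<otimes> inv (inv v)" using c by (simp add: nonzero_inverse_mult_distrib m_comm)
  then have "inv w \<otimes> inv (inv v) \<in> unit_set V" using unit_set_inv[OF V v(2)] by simp
  then show "inv w \<in> ?H" using conjugate_pair_inv[OF v(1)] c nonzero_imp_inverse_nonzero by auto
  fix w' assume w': "w' \<in> ?H"
  then obtain v' where v': "conjugate_pair F x y w' v'" "w' \<otimes> inv v' \<in> unit_set V" by auto
  have c': "w' \<in> carrier R" "w' \<noteq> \<zero>" "v' \<in> carrier R" "v' \<noteq> \<zero>" "inv v' \<in> carrier R"
    using w' conjugate_pair_carrier[OF v'(1)] conjugate_pair_inv[OF v'(1)] by auto
  have "(w \<otimes> w') \<otimes> inv (v \<otimes> v') = (w \<otimes> inv v) \<otimes> (w' \<otimes> inv v')"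
    using c c' by (simp add: nonzero_inverse_mult_distrib m_ac)
  then have "(w \<otimes> w') \<otimes> inv (v \<otimes> v') \<in> unit_set V" using unit_set_mult[OF V v(2) v'(2)] by simp
  then show "w \<otimes> w' \<in> ?H" using conjugate_pair_mult[OF v(1) v'(1)] c c' by (auto simp: integral_iff)
qed auto

text \<open>The valuation ring \<open>V i\<close> is chosen such that x - c_i is a nonunit while x -
  y and all x - c_j and y - c_j with j < i are units. The earlier terms then have unit quotients by
  their conjugates, but x - c_i does not, since its conjugate is a unit.\<close>

lemma separated_sequence_of_conjugates:
  assumes sep: "separable_by_valuations E F" and y': "(algebraic over F) y" and xy: "x \<noteq> y" and xF: "x \<notin> F"
  shows "\<exists>c H. (\<forall>i. c i \<in> F) \<and> separated_sequence (mult_of R) (F - {\<zero>}) (\<lambda>i. x \<ominus> c i) H"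
proof -
  note FE = subringE[OF base_subring]
  have pair: "conjugate_pair F x y (x \<ominus> c) (y \<ominus> c)" if "c \<in> F" for c
    by (rule conjugate_pair_minus[OF conjugate_pair_var conjugate_pair_const[OF that]])
  have ne: "x \<ominus> c \<noteq> \<zero>" "y \<ominus> c \<noteq> \<zero>" if c: "c \<in> F" for c
  proof -
    have cc: "c \<in> carrier R" using subsetD[OF FE(1) c] .
    show xc: "x \<ominus> c \<noteq> \<zero>"
    proof
      assume "x \<ominus> c = \<zero>"
      then have "x = c" using x cc by simp
      then show False using c xF by simp
    qed
    then show "y \<ominus> c \<noteq> \<zero>" using conjugate_pair_inv[OF pair[OF c]] by blast
  qed
  have alg_minus: "(algebraic over F) (a \<ominus> b)"
    if "a \<in> carrier R" "(algebraic over F) a" "b \<in> carrier R" "(algebraic over F) b" for a b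
    using subring_minus_closed[OF subfieldE(1)[OF subfield_of_algebraics[OF F]], of a b] that by simp
  define \<Phi> where "\<Phi> Z c \<longleftrightarrow> (\<exists>V. valuation_ring V \<and> inv (x \<ominus> c) \<notin> V \<and>
      insert (x \<ominus> y) ((\<lambda>z. x \<ominus> z) ` Z \<union> (\<lambda>z. y \<ominus> z) ` Z) \<subseteq> unit_set V)" for Z c
  have "\<exists>c\<in>F. \<Phi> Z c" if Z: "finite Z" "Z \<subseteq> F" for Z
  proof -
    let ?Y = "insert (x \<ominus> y) ((\<lambda>z. x \<ominus> z) ` Z \<union> (\<lambda>z. y \<ominus> z) ` Z)"
    have Zc: "z \<in> carrier R" "(algebraic over F) z" if "z \<in> Z" for z
      using that Z FE(1) algebraic_self[OF base_subring] by blast+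
    have "?Y \<subseteq> carrier R - {\<zero>}" using x(1) y xy ne Z Zc by auto
    moreover have "\<forall>z\<in>?Y. (algebraic over F) z" using alg_minus x y y' Zc by auto
    ultimately have pre: "x \<in> carrier R \<and> (algebraic over F) x \<and> finite ?Y \<and> ?Y \<subseteq> carrier R - {\<zero>} \<and>
        (\<forall>z\<in>?Y. (algebraic over F) z)"
      using x Z(1) by blast
    have "\<exists>c\<in>F. \<exists>V. valuation_ring V \<and> E \<subseteq> V \<and> x \<noteq> c \<and> inv (x \<ominus> c) \<notin> V \<and> ?Y \<subseteq> unit_set V"
      by (rule sep[unfolded separable_by_valuations_def, THEN spec, THEN spec, THEN mp, OF pre])
    then show ?thesis unfolding \<Phi>_def by blast
  qed
  then obtain c where c: "\<And>i::nat. c i \<in> F" "\<And>i. \<Phi> (c ` {..<i}) (c i)"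
    using finite_set_choice_sequence[of F \<Phi>] by blast
  then obtain V where V: "\<And>i. valuation_ring (V i)" "\<And>i. inv (x \<ominus> c i) \<notin> V i"
    "\<And>i. insert (x \<ominus> y) ((\<lambda>z. x \<ominus> z) ` c ` {..<i} \<union> (\<lambda>z. y \<ominus> z) ` c ` {..<i}) \<subseteq> unit_set (V i)"
    unfolding \<Phi>_def by metis
  define H where "H i = {w \<in> carrier R - {\<zero>}. \<exists>v. conjugate_pair F x y w v \<and> w \<otimes> inv v \<in> unit_set (V i)}" for i
  have cc: "c i \<in> carrier R" for i using subsetD[OF FE(1) c(1)] .
  have "separated_sequence (mult_of R) (F - {\<zero>}) (\<lambda>i. x \<ominus> c i) H"
    unfolding separated_sequence_def
  proof (intro allI conjI impI)
    fix i
    note VS = valuation_ring_subring[OF V(1)[of i]]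
    show "x \<ominus> c i \<in> carrier (mult_of R)" using ne(1)[OF c(1)[of i]] cc x by simp
    show "subgroup (H i) (mult_of R)" unfolding H_def by (rule subgroup_conjugate_ratio[OF VS])
    show "F - {\<zero>} \<subseteq> H i"
    proof
      fix a assume a: "a \<in> F - {\<zero>}"
      then have "a \<otimes> inv a \<in> unit_set (V i)" using FE(1) unit_set_one[OF VS] by auto
      then show "a \<in> H i" using conjugate_pair_const a FE(1) unfolding H_def by auto
    qed
    show "x \<ominus> c j \<in> H i" if "j < i" for j
    proof -
      have "x \<ominus> c j \<in> unit_set (V i)" "y \<ominus> c j \<in> unit_set (V i)" using V(3)[of i] that by auto
      then have "(x \<ominus> c j) \<otimes> inv (y \<ominus> c j) \<in> unit_set (V i)" using unit_set_mult[OF VS] unit_set_inv[OF VS] by blast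
      then show ?thesis using pair[OF c(1)] ne(1)[OF c(1)] cc x unfolding H_def by auto
    qed
    show "(x \<ominus> c i) [^]\<^bsub>mult_of R\<^esub> k \<notin> H i" if k: "k > 0" for k :: nat
    proof
      assume "(x \<ominus> c i) [^]\<^bsub>mult_of R\<^esub> k \<in> H i"
      then obtain v where v: "conjugate_pair F x y ((x \<ominus> c i) [^] k) v" "(x \<ominus> c i) [^] k \<otimes> inv v \<in> unit_set (V i)"
        unfolding H_def Multiplicative_Group.nat_pow_mult_of by auto
      define d g where "d = x \<ominus> c i" and "g = y \<ominus> c i"
      have dg: "d \<in> carrier R" "d \<noteq> \<zero>" "g \<in> carrier R" "g \<noteq> \<zero>" using ne[OF c(1)] cc x y by (auto simp: d_def g_def)
      have "v = g [^] k" using conjugate_pair_unique[OF v(1) conjugate_pair_pow[OF pair[OF c(1)]]] by (simp add: g_def)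
      then have unit: "d [^] k \<otimes> inv (g [^] k) \<in> unit_set (V i)" using v(2) by (simp add: d_def)
      have id: "inv d \<notin> V i" using V(2) by (simp add: d_def)
      \<comment> \<open>The conjugate \<open>g\<close> is the difference of the nonunit
        \<open>d\<close> and the unit x - y, hence a unit; this is why x - y was put among the
        prescribed units.\<close>
      have "d \<ominus> (x \<ominus> y) \<in> unit_set (V i)"
        using valuation_ring_nonunit_minus_unit[OF V(1) dg(1,2) id] V(3)[of i] by blast
      also have "d \<ominus> (x \<ominus> y) = g" unfolding d_def g_def using x(1) y cc[of i] by algebra
      finally have g: "g \<in> unit_set (V i)" .
      define r where "r = d \<otimes> inv g"
      have ig: "inv g \<in> carrier R" "inv g \<noteq> \<zero>" using dg nonzero_imp_inverse_nonzero by auto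
      have r: "r \<in> carrier R" "r \<noteq> \<zero>" using dg ig by (auto simp: r_def integral_iff)
      have "inv r \<notin> V i"
      proof
        assume "inv r \<in> V i"
        then have "inv g \<otimes> inv r \<in> V i" using g subringE(6)[OF VS] by (auto simp: unit_set_def)
        moreover have "inv r = g \<otimes> inv d"
          using dg ig by (simp add: r_def nonzero_inverse_mult_distrib nonzero_inverse_inverse_eq)
        moreover have "inv g \<otimes> (g \<otimes> inv d) = inv d" using dg ig by (simp flip: m_assoc)
        ultimately show False using id by simp
      qed
      then have "r [^] k \<notin> unit_set (V i)" by (rule pow_notin_unit_set[OF V(1) r _ k])
      moreover have "r [^] k = d [^] k \<otimes> inv (g [^] k)"
      proof -
        have "g [^] k \<otimes> inv g [^] k = (g \<otimes> inv g) [^] k" using dg ig by (intro nat_pow_distrib[symmetric])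
        also have "\<dots> = \<one>" using dg by simp
        finally have "inv (g [^] k) = inv g [^] k" using dg ig by (intro comm_inv_char) auto
        then show ?thesis using dg ig by (simp add: r_def nat_pow_distrib)
      qed
      ultimately show False using unit by simp
    qed
  qed
  then show ?thesis using c(1) by blast
qed

end

section \<open>A second root of the minimal polynomial\<close>

lemma lead_coeff_monic_linear_pow:
  assumes "x \<in> carrier R"
  shows "[\<one>, \<ominus> x] [^]\<^bsub>poly_ring R\<^esub> (n::nat) \<in> carrier (poly_ring R) \<and> hd ([\<one>, \<ominus> x] [^]\<^bsub>poly_ring R\<^esub> n) = \<one>
    \<and> [\<one>, \<ominus> x] [^]\<^bsub>poly_ring R\<^esub> n \<noteq> []"
proof (induction n)
  case 0
  then show ?case by (auto simp: univ_poly_one univ_poly_def polynomial_def)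
next
  case (Suc n)
  interpret P: ring "poly_ring R" by (rule univ_poly_is_ring[OF carrier_is_subring])
  define p where "p = [\<one>, \<ominus> x] [^]\<^bsub>poly_ring R\<^esub> n"
  have p: "p \<in> carrier (poly_ring R)" "hd p = \<one>" "p \<noteq> []" using Suc by (auto simp: p_def)
  have l: "[\<one>, \<ominus> x] \<in> carrier (poly_ring R)" using assms by (auto simp: univ_poly_def polynomial_def)
  have "hd (poly_mult p [\<one>, \<ominus> x]) = \<one> \<otimes> \<one>"
    using poly_mult_lead_coeff[OF carrier_is_subring, of p "[\<one>, \<ominus> x]"] p l by (simp add: univ_poly_carrier)
  moreover have "poly_mult p [\<one>, \<ominus> x] \<noteq> []"
    using poly_mult_integral[OF carrier_is_subring, of p "[\<one>, \<ominus> x]"] p l by (auto simp: univ_poly_carrier)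
  moreover have "[\<one>, \<ominus> x] [^]\<^bsub>poly_ring R\<^esub> Suc n = poly_mult p [\<one>, \<ominus> x]" by (simp add: p_def univ_poly_mult)
  moreover have "p \<otimes>\<^bsub>poly_ring R\<^esub> [\<one>, \<ominus> x] \<in> carrier (poly_ring R)" using p l by simp
  ultimately show ?case by (simp add: univ_poly_mult)
qed

lemma eval_zero_monic_linear_pow:
  assumes "x \<in> carrier R"
  shows "eval ([\<one>, \<ominus> x] [^]\<^bsub>poly_ring R\<^esub> (n::nat)) \<zero> = (\<ominus> x) [^] n"
proof -
  interpret h: ring_hom_ring "poly_ring R" R "\<lambda>p. eval p \<zero>" by (rule eval_ring_hom[OF carrier_is_subring zero_closed])
  have l: "[\<one>, \<ominus> x] \<in> carrier (poly_ring R)" using assms by (auto simp: univ_poly_def polynomial_def)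
  show ?thesis using h.hom_nat_pow[OF l, of n] assms by simp
qed

end

text \<open>If \<open>x\<close> were the only root of its minimal polynomial, that polynomial would
  be a power of X - x, and its constant term would put a power of \<open>x\<close>, up to sign, into
  \<open>F\<close>; inseparable elements are covered as well. Any other root works because the
  minimal polynomial divides every \<open>p\<close> that vanishes at \<open>x\<close>.\<close>

lemma (in algebraically_closed) exists_other_conjugate:
  assumes F: "subfield F L" and x: "x \<in> carrier L" "(algebraic over F) x" and pow: "\<And>k::nat. k > 0 \<Longrightarrow> x [^] k \<notin> F"
  shows "\<exists>y\<in>carrier L. y \<noteq> x \<and> (algebraic over F) y \<and> (\<forall>p\<in>carrier (F [X]). eval p x = \<zero> \<longrightarrow> eval p y = \<zero>)"
proof -
  note FS = subfieldE(1)[OF F]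
  define f where "f = Irr F x"
  have f: "f \<in> carrier (F [X])" "pirreducible F f" "hd f = \<one>" "eval f x = \<zero>" using IrrE[OF F x] by (auto simp: f_def)
  have fL: "f \<in> carrier (poly_ring L)" by (rule carrier_polynomial_shell[OF FS f(1)])
  define n where "n = length f - 1"
  have n: "n \<ge> 1" using pirreducible_degree[OF F f(1,2)] by (simp add: n_def)
  then have fne: "f \<noteq> []" by (auto simp: n_def)
  have size: "size (roots f) = n" using roots_over_carrier[OF fL] by (simp add: splitted_def n_def)
  have "\<exists>y. y \<in># roots f \<and> y \<noteq> x"
  proof (rule ccontr)
    assume "\<nexists>y. y \<in># roots f \<and> y \<noteq> x"
    then have "set_mset (roots f) \<subseteq> {x}" by auto
    then have "roots f = replicate_mset (size (roots f)) x" by (metis set_mset_subset_singletonD)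
    then have "alg_mult f x = n" using size alg_mult_eq_count_roots[OF fL] by (metis count_replicate_mset)
    then have "([\<one>, \<ominus> x] [^]\<^bsub>poly_ring L\<^esub> n) pdivides f" using alg_multE(1)[OF x(1) fL fne] by simp
    then obtain q where q: "q \<in> carrier (poly_ring L)" "f = poly_mult ([\<one>, \<ominus> x] [^]\<^bsub>poly_ring L\<^esub> n) q"
      unfolding pdivides_def by (auto simp: factor_def univ_poly_mult)
    define p where "p = [\<one>, \<ominus> x] [^]\<^bsub>poly_ring L\<^esub> n"
    have p: "p \<in> carrier (poly_ring L)" "hd p = \<one>" "p \<noteq> []" using lead_coeff_monic_linear_pow[OF x(1)] by (auto simp: p_def)
    have l: "[\<one>, \<ominus> x] \<in> carrier (poly_ring L)" using x by (auto simp: univ_poly_def polynomial_def)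
    have degp: "length p - 1 = n" using polynomial_pow_degree[OF l, of n] by (simp add: p_def)
    have poly: "polynomial (carrier L) p" "polynomial (carrier L) q" using p q by (auto simp: univ_poly_carrier)
    have fpq: "f = poly_mult p q" using q p_def by simp
    have qne: "q \<noteq> []"
    proof
      assume "q = []"
      then show False using fpq fne poly_mult_zero(2)[of p] polynomial_in_carrier[OF carrier_is_subring poly(1)] by simp
    qed
    \<comment> \<open>Equal degrees make the cofactor constant, and as both polynomials are monic it
      is 1.\<close>
    have "length f - 1 = (length p - 1) + (length q - 1)"
      using poly_mult_degree_eq[OF carrier_is_subring poly] fpq p(3) qne by simp
    then have "length q = 1" using degp qne unfolding n_def by (cases q) auto
    then obtain q0 where q0: "q = [q0]" by (metis length_Suc_conv length_0_conv One_nat_def)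
    have "q0 \<in> carrier L" using poly(2) q0 by (auto simp: polynomial_def)
    then have "q0 = \<one>" using poly_mult_lead_coeff[OF carrier_is_subring poly p(3) qne] fpq f(3) p(2) q0 by simp
    have "eval f \<zero> = eval p \<zero> \<otimes> eval q \<zero>"
      using eval_poly_mult[OF _ _ zero_closed, of p q] polynomial_in_carrier[OF carrier_is_subring] poly fpq by simp
    also have "\<dots> = (\<ominus> x) [^] n" using q0 \<open>q0 = \<one>\<close> eval_zero_monic_linear_pow[OF x(1), of n] x(1) by (simp add: p_def)
    finally have "(\<ominus> x) [^] n \<in> F" using const_term_simprules_shell(1)[OF FS f(1)] by (simp add: const_term_def)
    \<comment> \<open>Squaring removes the sign.\<close>
    then have "(\<ominus> x) [^] n \<otimes> (\<ominus> x) [^] n \<in> F" using subringE(6)[OF FS] by blast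
    also have "(\<ominus> x) [^] n \<otimes> (\<ominus> x) [^] n = x [^] n \<otimes> x [^] n"
    proof -
      have "(\<ominus> x) \<otimes> (\<ominus> x) = x \<otimes> x" using x by (simp add: l_minus r_minus)
      then show ?thesis using x by (metis a_inv_closed nat_pow_distrib)
    qed
    also have "\<dots> = x [^] (n + n)" using x by (simp add: nat_pow_mult)
    finally show False using pow[of "n + n"] n by simp
  qed
  then obtain y where y: "y \<in># roots f" "y \<noteq> x" by blast
  then have yr: "y \<in> carrier L" "eval f y = \<zero>" using roots_mem_iff_is_root[OF fL] by (auto simp: is_root_def)
  have "(algebraic over F) y" by (rule algebraicI[OF f(1) fne yr(2)])
  moreover have "eval p y = \<zero>" if p: "p \<in> carrier (F [X])" "eval p x = \<zero>" for p
    using pdivides_imp_root_sharing[OF fL _ yr(1,2)] Irr_minimal[OF F x p] by (simp add: f_def)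
  ultimately show ?thesis using y yr by blast
qed

section \<open>Independence modulo a subfield\<close>

context field
begin

text \<open>For transcendental \<open>x\<close>, constants from the whole field serve, with
  valuation rings containing \<open>F\<close>. For algebraic \<open>x\<close> a second conjugate may
  exist only in an algebraic closure; the sequence built there consists of differences of the image
  of \<open>x\<close> and elements of the image of \<open>F\<close>, so it comes from the field
  itself and can be pulled back.\<close>

lemma separated_sequence_mod_subfield:
  assumes F: "subfield F R" and x: "x \<in> carrier R" "\<And>k::nat. k > 0 \<Longrightarrow> x [^] k \<notin> F"
  shows "\<exists>b H. separated_sequence (mult_of R) (F - {\<zero>}) b H"
proof (cases "(algebraic over F) x")
  case False
  then have "separable_by_valuations F (carrier R)"
    using separable_by_valuations_transcendental[OF subfieldE(1)[OF F] carrier_is_subfield] x(1) subringE(1)[OF subfieldE(1)[OF F]]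
    by (auto simp: over_def)
  then show ?thesis
    using separated_sequence_of_constants[OF _ carrier_is_subfield] unit_set_subfield[OF F] by metis
next
  case True
  let ?L = "alg_closure" and ?h = "indexed_const :: 'a \<Rightarrow> ('a list \<times> nat) multiset \<Rightarrow> 'a"
  interpret L: algebraic_closure alg_closure "indexed_const ` (carrier R)" by (rule alg_closureE(1))
  have h: "?h \<in> ring_hom R ?L" by (rule alg_closureE(2))
  interpret h: ring_hom_ring R ?L ?h by (rule ring_hom_ringI2[OF ring_axioms L.ring_axioms h])
  have inj: "inj_on ?h (carrier R)" by (rule indexed_const_inj_on)
  have hz: "?h z = \<zero>\<^bsub>?L\<^esub> \<longleftrightarrow> z = \<zero>" if "z \<in> carrier R" for z
    using inj that h.hom_zero by (metis inj_onD zero_closed)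
  note FE = subringE[OF subfieldE(1)[OF F]]
  define F' where "F' = ?h ` F"
  define x' where "x' = ?h x"
  have F': "subfield F' ?L" unfolding F'_def using h.img_is_subfield(2)[OF F L.one_not_zero] by simp
  have x'c: "x' \<in> carrier ?L" using x by (simp add: x'_def)
  have x'a: "((ring.algebraic ?L) over F') x'" unfolding F'_def x'_def
    by (rule algebraic_hom[OF h field_axioms L.field_axioms F x(1) True])
  have x'p: "x' [^]\<^bsub>?L\<^esub> k \<notin> F'" if "k > 0" for k :: nat
  proof
    assume "x' [^]\<^bsub>?L\<^esub> k \<in> F'"
    then have "?h (x [^] k) \<in> ?h ` F" using h.hom_nat_pow[OF x(1)] by (simp add: x'_def F'_def)
    then have "x [^] k \<in> F" using inj FE(1) x(1) by (metis inj_on_image_mem_iff nat_pow_closed)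
    then show False using x(2)[OF that] by simp
  qed
  obtain y where y: "y \<in> carrier ?L" "y \<noteq> x'" "((ring.algebraic ?L) over F') y"
    "\<And>p. p \<in> carrier (F' [X]\<^bsub>?L\<^esub>) \<Longrightarrow> ring.eval ?L p x' = \<zero>\<^bsub>?L\<^esub> \<Longrightarrow> ring.eval ?L p y = \<zero>\<^bsub>?L\<^esub>"
    using L.exists_other_conjugate[OF F' x'c x'a x'p] by blast
  have x'0: "x' \<noteq> \<zero>\<^bsub>?L\<^esub>" using x'p[of 1] subringE(2)[OF subfieldE(1)[OF F']] x'c by auto
  have "x' [^]\<^bsub>?L\<^esub> k \<noteq> \<one>\<^bsub>?L\<^esub>" if "k > 0" for k :: nat
    using x'p[OF that] subringE(3)[OF subfieldE(1)[OF F']] by auto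
  then have "L.separable_by_valuations L.prime_ring F'"
    using L.separable_by_valuations_prime_ring[OF F' x'c x'0 x'a] by blast
  moreover have "x' \<notin> F'" using x'p[of 1] x'c by simp
  ultimately obtain c H where c: "\<And>i. c i \<in> F'"
    and sep: "separated_sequence (mult_of ?L) (F' - {\<zero>\<^bsub>?L\<^esub>}) (\<lambda>i. x' \<ominus>\<^bsub>?L\<^esub> c i) H"
    using L.separated_sequence_of_conjugates[OF F' x'c x'a y(1) y(4) _ y(3)] y(2) by metis
  have "\<exists>d. \<forall>i. d i \<in> F \<and> c i = ?h (d i)" using c unfolding F'_def by (intro choice) auto
  then obtain d where d: "\<And>i. d i \<in> F" "\<And>i. c i = ?h (d i)" by blast
  have dc: "d i \<in> carrier R" for i using subsetD[OF FE(1) d(1)] .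
  have eq: "x' \<ominus>\<^bsub>?L\<^esub> c i = ?h (x \<ominus> d i)" for i using x dc d(2) by (simp add: x'_def minus_eq L.minus_eq)
  have "group_hom (mult_of R) (mult_of ?L) ?h"
    using field_mult_group L.field_mult_group hz by (auto simp: group_hom_def group_hom_axioms_def hom_def)
  moreover have "x \<ominus> d i \<in> carrier (mult_of R)" for i
  proof -
    have "x' \<ominus>\<^bsub>?L\<^esub> c i \<in> carrier (mult_of ?L)" using sep by (simp add: separated_sequence_def)
    then show ?thesis using hz[of "x \<ominus> d i"] x dc unfolding eq by auto
  qed
  moreover have "F - {\<zero>} \<subseteq> carrier (mult_of R)" using FE(1) by auto
  moreover have "?h ` (F - {\<zero>}) \<subseteq> F' - {\<zero>\<^bsub>?L\<^esub>}" using hz FE(1) by (auto simp: F'_def)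
  ultimately show ?thesis using separated_sequence_vimage[where b = "\<lambda>i. x \<ominus> d i" and h = ?h, OF _ _ _ _ sep[unfolded eq]] by blast
qed

end

theorem theorem4p1:
  fixes K :: "('a, 'b) ring_scheme" and F :: "'a set"
  assumes "field K" and "subfield F K"
  shows "(rational_rank (Multiplicative_Group.mult_of (K\<lparr>carrier := F\<rparr>)) =o (czero :: 'a rel) \<or>
          cinfinite (rational_rank (Multiplicative_Group.mult_of (K\<lparr>carrier := F\<rparr>)))) \<and>
         (rational_rank (Multiplicative_Group.mult_of K Mod carrier (Multiplicative_Group.mult_of (K\<lparr>carrier := F\<rparr>))) =o (czero :: 'a set rel) \<or>
          cinfinite (rational_rank (Multiplicative_Group.mult_of K Mod carrier (Multiplicative_Group.mult_of (K\<lparr>carrier := F\<rparr>)))))"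
proof -
  interpret K: field K by (rule assms(1))
  interpret F: field "K\<lparr>carrier := F\<rparr>" by (rule K.subfield_iff(2)[OF assms(2)])
  interpret G: comm_group "Multiplicative_Group.mult_of K" by (rule K.mult_of_comm_group)
  have car: "carrier (Multiplicative_Group.mult_of (K\<lparr>carrier := F\<rparr>)) = F - {\<zero>\<^bsub>K\<^esub>}" by simp
  have sub: "subgroup (F - {\<zero>\<^bsub>K\<^esub>}) (Multiplicative_Group.mult_of K)" by (rule K.subgroup_mult_of[OF assms(2)])
  have "rational_rank (Multiplicative_Group.mult_of K Mod (F - {\<zero>\<^bsub>K\<^esub>})) =o (czero :: 'a set rel) \<or>
      cinfinite (rational_rank (Multiplicative_Group.mult_of K Mod (F - {\<zero>\<^bsub>K\<^esub>})))"
  proof (rule G.rational_rank_Mod_zero_or_infinite[OF sub])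
    fix x assume x: "x \<in> carrier (Multiplicative_Group.mult_of K)"
      "\<And>k::nat. k > 0 \<Longrightarrow> x [^]\<^bsub>Multiplicative_Group.mult_of K\<^esub> k \<notin> F - {\<zero>\<^bsub>K\<^esub>}"
    then have "x [^]\<^bsub>K\<^esub> k \<notin> F" if "k > 0" for k :: nat
      using that by (auto simp: Multiplicative_Group.nat_pow_mult_of)
    then show "\<exists>b H. separated_sequence (Multiplicative_Group.mult_of K) (F - {\<zero>\<^bsub>K\<^esub>}) b H"
      using K.separated_sequence_mod_subfield[OF assms(2), of x] x(1) by auto
  qed
  then show ?thesis using F.rational_rank_mult_of_zero_or_infinite unfolding car by blast
qed

end
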